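(* Let $n=1$, $\mu>0$, $\beta>1$, $R\ge 1$ and $p>1$. Assume that $f\in H^1(\mathbb{R})$ and $g\in L^2(\mathbb{R})$ are both non-negative, that $f$ does not vanish identically, and that $$\int_{\mathbb{R}}g(x)\,dx\neq 0.$$ Then there exist a constant $\varepsilon_0=\varepsilon_0(f,g,p,\mu,\beta,R)>0$ and a positive constant $C$ independent of $\varepsilon$ such that the following holds for every $0<\varepsilon\le\varepsilon_0$: if $T>0$ and $u$ is an energy solution over $[0,T)$ of $$u_{tt}-u_{xx}+\frac{\mu}{(1+t)^\beta}u_t=|u|^p,\qquad u(x,0)=\varepsilon f(x),\quad u_t(x,0)=\varepsilon g(x),\qquad x\in\mathbb{R},$$ satisfying $$\operatorname{supp} u\subset\{(x,t)\in\mathbb{R}\times[0,T): |x|\le t+R\},$$ then $$T\le C\,\varepsilon^{-(p-1)/2}.$$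
   Context: Functions are real-valued. Energy solution (here $n=1$): $u$ is an energy solution over $[0,T)$ of the initial value problem if $$u\in C([0,T),H^1(\mathbb{R}^n))\cap C^1([0,T),L^2(\mathbb{R}^n))\cap L^p_{\rm loc}(\mathbb{R}^n\times(0,T)),$$ $u(\cdot,0)=\varepsilon f$, $u_t(\cdot,0)=\varepsilon g$, and $$\int_{\mathbb{R}^n}u_t(x,t)\phi(x,t)\,dx-\int_{\mathbb{R}^n}u_t(x,0)\phi(x,0)\,dx+\int_0^t ds\int_{\mathbb{R}^n}\left\{-u_t(x,s)\phi_t(x,s)+\nabla u(x,s)\cdot\nabla\phi(x,s)\right\}dx$$ $$+\int_0^t ds\int_{\mathbb{R}^n}\frac{\mu u_t(x,s)}{(1+s)^{\beta}}\phi(x,s)\,dx=\int_0^t ds\int_{\mathbb{R}^n}|u(x,s)|^p\phi(x,s)\,dx$$ for every $\phi\in C_0^\infty(\mathbb{R}^n\times[0,T))$ and every $t\in[0,T)$. *)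

theory Defs
  imports "HOL-Analysis.Analysis"
begin

(* Elements of L^2(R) and H^1(R) are represented by Lebesgue measurable functions; every
   condition below is invariant under changing them on null sets.  Functions of space and time
   are functions of the pair (x, t). *)

section \<open>Smooth functions and test functions\<close>

(* Derivatives are taken within S, so that on S = R x [0, T) the time derivatives at t = 0 are
   one-sided and the values of f outside S play no role.  On the convex sets with nonempty
   interior used below the derivative within S is unique. *)
fun C_k_on :: "nat \<Rightarrow> 'a::real_normed_vector set \<Rightarrow> ('a \<Rightarrow> real) \<Rightarrow> bool" where
  "C_k_on 0 S f \<longleftrightarrow> continuous_on S f"
| "C_k_on (Suc k) S f \<longleftrightarrow>
     (\<exists>f'. (\<forall>z\<in>S. (f has_derivative f' z) (at z within S)) \<and> (\<forall>v. C_k_on k S (\<lambda>z. f' z v)))"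

definition smooth_on :: "'a::real_normed_vector set \<Rightarrow> ('a \<Rightarrow> real) \<Rightarrow> bool" where
  "smooth_on S f \<longleftrightarrow> (\<forall>k. C_k_on k S f)"

(* C_0^\<infinity>(S): the support is a compact subset of S; for S = R x [0, T) it may meet t = 0. *)
definition test_functions :: "'a::real_normed_vector set \<Rightarrow> ('a \<Rightarrow> real) set" where
  "test_functions S =
     {\<phi>. smooth_on S \<phi> \<and> compact (closure {z\<in>S. \<phi> z \<noteq> 0}) \<and> closure {z\<in>S. \<phi> z \<noteq> 0} \<subseteq> S}"

section \<open>Lebesgue and Sobolev spaces on the real line\<close>

definition L2 :: "(real \<Rightarrow> real) set" where
  "L2 = {f. f \<in> borel_measurable lebesgue \<and> integrable lebesgue (\<lambda>x. (f x)\<^sup>2)}"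

definition L2_norm :: "(real \<Rightarrow> real) \<Rightarrow> real" where
  "L2_norm f = sqrt (LINT x|lebesgue. (f x)\<^sup>2)"

definition has_weak_derivative :: "(real \<Rightarrow> real) \<Rightarrow> (real \<Rightarrow> real) \<Rightarrow> bool" where
  "has_weak_derivative f w \<longleftrightarrow>
     (\<forall>\<psi>\<in>test_functions UNIV.
        (LINT x|lebesgue. f x * deriv \<psi> x) = - (LINT x|lebesgue. w x * \<psi> x))"

definition H1 :: "(real \<Rightarrow> real) set" where
  "H1 = {f\<in>L2. \<exists>w\<in>L2. has_weak_derivative f w}"

section \<open>Continuous curves in these spaces\<close>

definition C_L2 :: "real set \<Rightarrow> (real \<Rightarrow> real \<Rightarrow> real) \<Rightarrow> bool" where
  "C_L2 I v \<longleftrightarrow> (\<forall>t\<in>I. v t \<in> L2) \<and>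
     (\<forall>t\<in>I. ((\<lambda>s. L2_norm (\<lambda>x. v s x - v t x)) \<longlongrightarrow> 0) (at t within I))"

(* v \<in> C(I, H^1) with spatial weak derivative w, in the norm (|v|^2 + |w|^2)^(1/2). *)
definition C_H1_with :: "real set \<Rightarrow> (real \<Rightarrow> real \<Rightarrow> real) \<Rightarrow> (real \<Rightarrow> real \<Rightarrow> real) \<Rightarrow> bool" where
  "C_H1_with I v w \<longleftrightarrow>
     (\<forall>t\<in>I. v t \<in> L2 \<and> w t \<in> L2 \<and> has_weak_derivative (v t) (w t)) \<and>
     (\<forall>t\<in>I. ((\<lambda>s. sqrt ((L2_norm (\<lambda>x. v s x - v t x))\<^sup>2 + (L2_norm (\<lambda>x. w s x - w t x))\<^sup>2))
                \<longlongrightarrow> 0) (at t within I))"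

(* v \<in> C^1(I, L^2) with time derivative w. *)
definition C1_L2_with :: "real set \<Rightarrow> (real \<Rightarrow> real \<Rightarrow> real) \<Rightarrow> (real \<Rightarrow> real \<Rightarrow> real) \<Rightarrow> bool" where
  "C1_L2_with I v w \<longleftrightarrow> (\<forall>t\<in>I. v t \<in> L2) \<and> C_L2 I w \<and>
     (\<forall>t\<in>I. ((\<lambda>s. L2_norm (\<lambda>x. (v s x - v t x) / (s - t) - w t x)) \<longlongrightarrow> 0) (at t within I))"

definition Lp_loc :: "real \<Rightarrow> (real \<times> real) set \<Rightarrow> (real \<times> real \<Rightarrow> real) \<Rightarrow> bool" where
  "Lp_loc p S u \<longleftrightarrow> set_borel_measurable lebesgue S u \<and>
     (\<forall>K. compact K \<and> K \<subseteq> S \<longrightarrow> set_integrable lebesgue K (\<lambda>z. \<bar>u z\<bar> powr p))"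

(* Support relative to S of a function determined up to null sets: the complement in S of the
   largest relatively open set on which u vanishes almost everywhere. *)
definition ess_support :: "(real \<times> real) set \<Rightarrow> (real \<times> real \<Rightarrow> real) \<Rightarrow> (real \<times> real) set" where
  "ess_support S u =
     {z\<in>S. \<forall>U. open U \<and> z \<in> U \<longrightarrow> \<not> (AE y in lebesgue. y \<in> U \<inter> S \<longrightarrow> u y = 0)}"

section \<open>Energy solutions of the damped wave equation\<close>

definition partial_x :: "(real \<times> real \<Rightarrow> real) \<Rightarrow> real \<Rightarrow> real \<Rightarrow> real" where
  "partial_x \<phi> x t = deriv (\<lambda>y. \<phi> (y, t)) x"

definition partial_t :: "real \<Rightarrow> (real \<times> real \<Rightarrow> real) \<Rightarrow> real \<Rightarrow> real \<Rightarrow> real" where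
  "partial_t T \<phi> x t = vector_derivative (\<lambda>s. \<phi> (x, s)) (at t within {0..<T})"

(* Energy solution over [0, T) of  u_tt - u_xx + \<mu> (1 + t)^(-\<beta>) u_t = |u|^p  with data
   u(0) = u0 and u_t(0) = u1.  The witnesses ut t and ux t are the L^2 time derivative and the
   weak spatial derivative of u at time t; they are unique up to null sets. *)
definition energy_solution ::
  "real \<Rightarrow> real \<Rightarrow> real \<Rightarrow> real \<Rightarrow> (real \<Rightarrow> real) \<Rightarrow> (real \<Rightarrow> real) \<Rightarrow> (real \<times> real \<Rightarrow> real) \<Rightarrow> bool"
where
  "energy_solution p \<mu> \<beta> T u0 u1 u \<longleftrightarrow>
     Lp_loc p (UNIV \<times> {0<..<T}) u \<and>
     (\<exists>ut ux.
        C_H1_with {0..<T} (\<lambda>t x. u (x, t)) ux \<and>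
        C1_L2_with {0..<T} (\<lambda>t x. u (x, t)) ut \<and>
        (AE x in lebesgue. u (x, 0) = u0 x) \<and>
        (AE x in lebesgue. ut 0 x = u1 x) \<and>
        (\<forall>\<phi>\<in>test_functions (UNIV \<times> {0..<T}). \<forall>t\<in>{0..<T}.
           (LINT x|lebesgue. ut t x * \<phi> (x, t)) - (LINT x|lebesgue. ut 0 x * \<phi> (x, 0))
           + (LINT s:{0..t}|lebesgue. (LINT x|lebesgue.
                - ut s x * partial_t T \<phi> x s + ux s x * partial_x \<phi> x s))
           + (LINT s:{0..t}|lebesgue. (LINT x|lebesgue.
                \<mu> * ut s x / (1 + s) powr \<beta> * \<phi> (x, s)))
           = (LINT s:{0..t}|lebesgue. (LINT x|lebesgue. \<bar>u (x, s)\<bar> powr p * \<phi> (x, s)))))"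

end

theory Submission
  imports Defs
begin

text \<open>Testing the equation with a cutoff that equals \<open>1\<close> on the support of \<open>u\<close> shows that the
  average \<open>F(t) = \<integral> u(x, t) dx\<close> satisfies \<open>F'' + \<mu> (1 + t)\<^sup>-\<^sup>\<beta> F' = \<integral> \<bar>u\<bar>\<^sup>p dx\<close>, and Jensen's inequality
  on the interval of length \<open>2 (t + R)\<close> carrying \<open>u\<close> bounds the right-hand side below by
  \<open>(2 (t + R))\<^sup>1\<^sup>-\<^sup>p \<bar>F\<bar>\<^sup>p\<close>. For \<open>\<beta> > 1\<close> the integrating factor \<open>m(t) = exp (- \<mu> (1 + t)\<^sup>1\<^sup>-\<^sup>\<beta> / (\<beta> - 1))\<close> lies
  between two positive constants, so the damping only costs constants: \<open>F\<close> grows at least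
  like \<open>c \<epsilon> t\<close>, and on \<open>[\<tau>, 2\<tau>]\<close> it satisfies \<open>F'' \<ge> K F\<^sup>p\<close> in integrated form with
  \<open>K\<close> comparable to \<open>\<tau>\<^sup>1\<^sup>-\<^sup>p\<close>. Starting from \<open>F(\<tau>) \<ge> c \<epsilon> \<tau>\<close>, the times that \<open>F\<close> needs to double form a
  geometric series with sum comparable to \<open>\<epsilon> powr (- (p - 1) / 2)\<close>. If \<open>\<tau>\<close> exceeds a large multiple of that,
  \<open>F\<close> becomes infinite before \<open>2\<tau>\<close>.\<close>

section \<open>Smooth cutoff functions\<close>

text \<open>The polynomial parameter makes the family closed under differentiation;
  \<open>flat 1\<close> is the classical smooth function exp(-1/x), extended by zero.\<close>

definition flat :: "real poly \<Rightarrow> real \<Rightarrow> real" where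
  "flat P x = (if 0 < x then poly P (1 / x) * exp (- (1 / x)) else 0)"

lemma poly_times_exp_minus_tendsto_0:
  fixes P :: "real poly"
  shows "((\<lambda>y. poly P y * exp (- y)) \<longlongrightarrow> 0) at_top"
proof -
  have "((\<lambda>y. \<Sum>i\<le>degree P. coeff P i * (y ^ i / exp y)) \<longlongrightarrow> (\<Sum>i\<le>degree P. coeff P i * 0)) at_top"
    by (intro tendsto_intros tendsto_power_div_exp_0)
  then show ?thesis
    by (simp add: poly_altdef sum_distrib_right exp_minus divide_inverse mult.assoc)
qed

text \<open>With y = 1/x, the chain rule turns P(y) exp(-y) into y^2 (P - P')(y) exp(-y). At the
  origin the difference quotients tend to 0 because exp(-y) beats every polynomial.\<close>

lemma flat_has_real_derivative:
  "(flat P has_real_derivative flat (monom 1 2 * (P - pderiv P)) x) (at x)"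
proof -
  consider "x > 0" | "x < 0" | "x = 0" by linarith
  then show ?thesis
  proof cases
    case 1
    have d: "((\<lambda>x. poly P (1 / x) * exp (- (1 / x))) has_real_derivative
        flat (monom 1 2 * (P - pderiv P)) x) (at x)"
      using 1 by (auto intro!: derivative_eq_intros simp: flat_def poly_monom power2_eq_square field_simps)
    have "\<forall>\<^sub>F y in nhds x. y \<in> {0<..}"
      using 1 by (intro eventually_nhds_in_open) auto
    then have ev: "\<forall>\<^sub>F y in nhds x. poly P (1 / y) * exp (- (1 / y)) = flat P y"
      by eventually_elim (simp add: flat_def)
    show ?thesis
      using d DERIV_cong_ev[OF refl ev refl] by simp
  next
    case 2
    have "\<forall>\<^sub>F y in nhds x. y \<in> {..<0}"
      using 2 by (intro eventually_nhds_in_open) auto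
    then have ev: "\<forall>\<^sub>F y in nhds x. 0 = flat P y"
      by eventually_elim (simp add: flat_def)
    have d: "((\<lambda>x. 0) has_real_derivative flat (monom 1 2 * (P - pderiv P)) x) (at x)"
      using 2 by (simp add: flat_def)
    show ?thesis
      using d DERIV_cong_ev[OF refl ev refl] by simp
  next
    case 3
    \<comment> \<open>For h > 0 and y = 1/h, the quotient \<open>flat P h / h\<close> is y P(y)
      exp(-y), and \<open>pCons 0 P\<close> is the polynomial y P(y).\<close>
    have "((\<lambda>y. poly (pCons 0 P) y * exp (- y)) \<longlongrightarrow> 0) at_top"
      by (rule poly_times_exp_minus_tendsto_0)
    from filterlim_compose[OF this filterlim_inverse_at_top_right]
    have "((\<lambda>h. flat P h / h) \<longlongrightarrow> 0) (at_right 0)"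
      by (rule Lim_transform_eventually)
        (auto simp: eventually_at_filter flat_def field_simps intro!: always_eventually)
    moreover have "((\<lambda>h. flat P h / h) \<longlongrightarrow> 0) (at_left 0)"
      by (rule Lim_transform_eventually[OF tendsto_const])
        (auto simp: eventually_at_filter flat_def intro!: always_eventually)
    ultimately show ?thesis
      using 3 by (auto simp: DERIV_def flat_def filterlim_at_split)
  qed
qed

text \<open>A class of functions closed under differentiation, so that smoothness follows by
  induction on the order.\<close>

inductive smooth_alg :: "('a::real_normed_vector \<Rightarrow> real) \<Rightarrow> bool" where
  const: "smooth_alg (\<lambda>z. c)"
| flat: "bounded_linear l \<Longrightarrow> smooth_alg (\<lambda>z. flat P (l z + c))"
| add: "smooth_alg f \<Longrightarrow> smooth_alg g \<Longrightarrow> smooth_alg (\<lambda>z. f z + g z)"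
| mult: "smooth_alg f \<Longrightarrow> smooth_alg g \<Longrightarrow> smooth_alg (\<lambda>z. f z * g z)"
| inverse: "smooth_alg f \<Longrightarrow> (\<And>z. f z \<noteq> 0) \<Longrightarrow> smooth_alg (\<lambda>z. inverse (f z))"

lemma smooth_alg_has_derivative:
  assumes "smooth_alg f"
  shows "\<exists>f'. (\<forall>z. (f has_derivative f' z) (at z)) \<and> (\<forall>v. smooth_alg (\<lambda>z. f' z v))"
  using assms
proof induction
  case (const c)
  then show ?case
    by (intro exI[of _ "\<lambda>_ _. 0"]) (auto intro: smooth_alg.const)
next
  case (flat l P c)
  define Q where "Q = monom 1 2 * (P - pderiv P)"
  have "((\<lambda>z. flat P (l z + c)) has_derivative (\<lambda>v. l v * flat Q (l z + c))) (at z)" for z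
  proof -
    have "((\<lambda>z. l z + c) has_derivative l) (at z)"
      using bounded_linear_imp_has_derivative[OF flat] by (auto intro!: derivative_eq_intros)
    from has_derivative_compose[OF this, of "flat P" "(*) (flat Q (l z + c))"] show ?thesis
      using flat_has_real_derivative[of P "l z + c"]
      by (simp add: has_field_derivative_def Q_def mult.commute)
  qed
  moreover have "smooth_alg (\<lambda>z. l v * flat Q (l z + c))" for v
    using flat by (intro smooth_alg.intros)
  ultimately show ?case
    by (intro exI[of _ "\<lambda>z v. l v * flat Q (l z + c)"]) auto
next
  case (add f g)
  then obtain f' g' where "\<And>z. (f has_derivative f' z) (at z)" "\<And>v. smooth_alg (\<lambda>z. f' z v)"
    "\<And>z. (g has_derivative g' z) (at z)" "\<And>v. smooth_alg (\<lambda>z. g' z v)"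
    by blast
  then show ?case
    by (intro exI[of _ "\<lambda>z v. f' z v + g' z v"])
      (auto intro!: derivative_intros smooth_alg.intros)
next
  case (mult f g)
  then obtain f' g' where "\<And>z. (f has_derivative f' z) (at z)" "\<And>v. smooth_alg (\<lambda>z. f' z v)"
    "\<And>z. (g has_derivative g' z) (at z)" "\<And>v. smooth_alg (\<lambda>z. g' z v)"
    by blast
  then show ?case using mult.hyps
    by (intro exI[of _ "\<lambda>z v. f z * g' z v + f' z v * g z"])
      (auto intro!: derivative_intros smooth_alg.intros)
next
  case (inverse f)
  then obtain f' where f': "\<And>z. (f has_derivative f' z) (at z)" "\<And>v. smooth_alg (\<lambda>z. f' z v)"
    by blast
  \<comment> \<open>The factor -1 is written out so that the derivative is built from the rules of
    \<open>smooth_alg\<close>: a product with a constant replaces negation.\<close>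
  have "((\<lambda>z. inverse (f z)) has_derivative (\<lambda>v. - 1 * (inverse (f z) * f' z v * inverse (f z)))) (at z)" for z
    using Deriv.has_derivative_inverse[OF inverse.hyps(2) f'(1)] by simp
  moreover have "smooth_alg (\<lambda>z. - 1 * (inverse (f z) * f' z v * inverse (f z)))" for v
    by (intro smooth_alg.mult smooth_alg.const smooth_alg.inverse inverse.hyps f')
  ultimately show ?case
    by (intro exI[of _ "\<lambda>z v. - 1 * (inverse (f z) * f' z v * inverse (f z))"]) auto
qed

lemma smooth_alg_smooth_on:
  assumes "smooth_alg f"
  shows "smooth_on S f"
proof -
  have "C_k_on k S f" if "smooth_alg f" for k and f :: "'a \<Rightarrow> real"
    using that
  proof (induction k arbitrary: f)
    case 0
    obtain f' where f': "\<And>z. (f has_derivative f' z) (at z)"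
      using smooth_alg_has_derivative[OF 0] by blast
    then have "continuous_on S f"
      by (meson has_derivative_continuous_on has_derivative_at_withinI)
    then show ?case by simp
  next
    case (Suc k)
    obtain f' where f': "\<And>z. (f has_derivative f' z) (at z)" "\<And>v. smooth_alg (\<lambda>z. f' z v)"
      using smooth_alg_has_derivative[OF Suc.prems] by blast
    have "\<forall>z\<in>S. (f has_derivative f' z) (at z within S)"
      using has_derivative_at_withinI[OF f'(1)] by blast
    moreover have "\<forall>v. C_k_on k S (\<lambda>z. f' z v)"
      using Suc.IH[OF f'(2)] by blast
    ultimately show ?case by auto
  qed
  with assms show ?thesis
    by (simp add: smooth_on_def)
qed

text \<open>Allows one-variable profiles to be rescaled, reflected and lifted to the plane through
  \<open>fst\<close> and \<open>snd\<close>.\<close>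

lemma smooth_alg_compose_affine:
  assumes "smooth_alg f" "bounded_linear L"
  shows "smooth_alg (\<lambda>z. f (L z + d))"
  using assms
proof induction
  case (flat l P c)
  have "smooth_alg (\<lambda>z. flat P (l (L z) + (l d + c)))"
    by (rule smooth_alg.flat[OF bounded_linear_compose[OF flat(1) flat(2)]])
  then show ?case
    using bounded_linear.linear[OF flat(1)] by (simp add: linear_add add.assoc)
qed (simp_all add: smooth_alg.intros)

lemma smooth_alg_has_real_derivative:
  fixes f :: "real \<Rightarrow> real"
  assumes "smooth_alg f"
  obtains f' where "smooth_alg f'" "\<And>x. (f has_real_derivative f' x) (at x)"
proof -
  obtain D where D: "\<And>z. (f has_derivative D z) (at z)" "\<And>v. smooth_alg (\<lambda>z. D z v)"
    using smooth_alg_has_derivative[OF assms] by blast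
  have "D z = (*) (D z 1)" for z
  proof
    show "D z v = D z 1 * v" for v
      using linear_cmul[OF has_derivative_linear[OF D(1)], of z v 1] by (simp add: mult.commute)
  qed
  then have "(f has_real_derivative D x 1) (at x)" for x
    using D(1)[of x] by (simp add: has_field_derivative_def)
  then show ?thesis
    by (rule that[OF D(2)])
qed

section \<open>Test functions, smooth steps and bumps\<close>

lemma test_functionsI:
  assumes "smooth_alg f" "compact K" "K \<subseteq> S" "\<And>z. z \<notin> K \<Longrightarrow> f z = 0"
  shows "f \<in> test_functions S"
proof -
  have sub: "closure {z \<in> S. f z \<noteq> 0} \<subseteq> K"
    using assms by (intro closure_minimal compact_imp_closed) auto
  have "compact (K \<inter> closure {z \<in> S. f z \<noteq> 0})"
    using \<open>compact K\<close> closed_closure by (rule compact_Int_closed)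
  then have "compact (closure {z \<in> S. f z \<noteq> 0})"
    using sub by (simp add: Int_absorb1)
  then show ?thesis
    using sub assms smooth_alg_smooth_on[OF assms(1)] by (auto simp: test_functions_def)
qed

text \<open>The standard transition from 0 to 1 across [0, 1]. The denominator never vanishes, as x
  and 1 - x cannot both be nonpositive.\<close>

definition smooth_step :: "real \<Rightarrow> real" where
  "smooth_step x = flat 1 x * inverse (flat 1 x + flat 1 (1 - x))"

lemma flat_one_pos: "0 < x \<Longrightarrow> 0 < flat 1 x"
  and flat_one_eq_0: "x \<le> 0 \<Longrightarrow> flat 1 x = 0"
  and flat_one_nonneg: "0 \<le> flat 1 x"
  by (simp_all add: flat_def)

lemma flat_one_sum_pos: "0 < flat 1 x + flat 1 (1 - x)"
proof (cases "0 < x")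
  case True
  then show ?thesis using flat_one_pos[of x] flat_one_nonneg[of "1 - x"] by linarith
next
  case False
  then show ?thesis using flat_one_pos[of "1 - x"] flat_one_nonneg[of x] by linarith
qed

lemma smooth_alg_smooth_step: "smooth_alg smooth_step"
proof -
  have "smooth_alg (\<lambda>x. flat 1 (x + 0))" "smooth_alg (\<lambda>x::real. flat 1 (- x + 1))"
    by (rule smooth_alg.flat, rule bounded_linear_ident,
        rule smooth_alg.flat, rule bounded_linear_minus, rule bounded_linear_ident)
  then have *: "smooth_alg (\<lambda>x. flat 1 x)" "smooth_alg (\<lambda>x::real. flat 1 (1 - x))"
    by (simp_all add: add.commute)
  have "flat 1 x + flat 1 (1 - x) \<noteq> 0" for x
    using flat_one_sum_pos[of x] by simp
  then have "smooth_alg (\<lambda>x. flat 1 x * inverse (flat 1 x + flat 1 (1 - x)))"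
    by (intro smooth_alg.mult smooth_alg.inverse smooth_alg.add *)
  then show ?thesis
    by (simp add: smooth_step_def[abs_def])
qed

lemma smooth_step_eq_0: "x \<le> 0 \<Longrightarrow> smooth_step x = 0"
  by (simp add: smooth_step_def flat_one_eq_0)

lemma smooth_step_eq_1: "1 \<le> x \<Longrightarrow> smooth_step x = 1"
  using flat_one_pos[of x] by (simp add: smooth_step_def flat_one_eq_0)

lemma smooth_step_range: "smooth_step x \<in> {0..1}"
  using flat_one_sum_pos[of x] flat_one_nonneg[of x] flat_one_nonneg[of "1 - x"]
  by (simp add: smooth_step_def flip: divide_inverse)

lemma smooth_bump_exists:
  fixes a b w :: real
  assumes "w > 0"
  obtains \<psi> where "smooth_alg \<psi>" "\<And>x. \<psi> x \<in> {0..1}" "\<And>x. x \<in> {a..b} \<Longrightarrow> \<psi> x = 1"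
    "\<And>x. x \<notin> {a - w..b + w} \<Longrightarrow> \<psi> x = 0"
proof
  \<comment> \<open>One step rises across [a - w, a], the other falls across [b, b + w]. Their
    arguments (x - (a - w)) / w and (b + w - x) / w are split into a linear part and a constant to
    fit \<open>smooth_alg_compose_affine\<close>.\<close>
  define \<psi> where "\<psi> x = smooth_step (x /\<^sub>R w + (1 - a / w)) * smooth_step (- x /\<^sub>R w + (1 + b / w))" for x
  have "bounded_linear (\<lambda>x::real. - x /\<^sub>R w)"
    by (intro bounded_linear_compose[OF bounded_linear_scaleR_right bounded_linear_minus] bounded_linear_ident)
  then show "smooth_alg \<psi>"
    unfolding \<psi>_def
    by (intro smooth_alg.mult smooth_alg_compose_affine[of smooth_step] smooth_alg_smooth_step bounded_linear_scaleR_right)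
  show "\<psi> x \<in> {0..1}" for x
    using smooth_step_range by (auto simp: \<psi>_def intro!: mult_le_one)
  show "\<psi> x = 1" if "x \<in> {a..b}" for x
    using that assms by (simp add: \<psi>_def smooth_step_eq_1 field_simps)
  show "\<psi> x = 0" if "x \<notin> {a - w..b + w}" for x
  proof -
    have "x /\<^sub>R w + (1 - a / w) = (x - (a - w)) / w" "- x /\<^sub>R w + (1 + b / w) = (b + w - x) / w"
      using assms by (simp_all add: field_simps)
    then have "x /\<^sub>R w + (1 - a / w) \<le> 0 \<or> - x /\<^sub>R w + (1 + b / w) \<le> 0"
      using that assms by (auto simp: divide_le_0_iff)
    then show ?thesis by (auto simp: \<psi>_def smooth_step_eq_0)
  qed
qed

section \<open>Integral inequalities with blow-up\<close>

lemma nondecreasing_of_derivative_within: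
  fixes f f' :: "real \<Rightarrow> real"
  assumes "s \<le> r" and "{s..r} \<subseteq> A"
    and der: "\<And>t. t \<in> {s..r} \<Longrightarrow> (f has_real_derivative f' t) (at t within A)"
    and nonneg: "\<And>t. t \<in> {s..r} \<Longrightarrow> 0 \<le> f' t"
  shows "f s \<le> f r"
proof -
  have d: "(f has_real_derivative f' t) (at t within {s..r})" if "t \<in> {s..r}" for t
    using der[OF that] assms(2) by (rule DERIV_subset)
  show ?thesis
  proof (rule DERIV_nonneg_imp_increasing_open[OF \<open>s \<le> r\<close>])
    show "\<exists>y. (f has_real_derivative y) (at t) \<and> 0 \<le> y" if "s < t" "t < r" for t
    proof -
      have "at t within {s..r} = at t"
        using that by (intro at_within_interior) auto
      then show ?thesis using d[of t] nonneg[of t] that by auto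
    qed
    show "continuous_on {s..r} f"
      using d by (rule DERIV_continuous_on)
  qed
qed

text \<open>From the level \<open>2 ^ j * a\<close>, \<open>F\<close> doubles within time \<open>h * q ^ j\<close>, where \<open>q = 2 powr (- (p - 1) / 2)\<close>.\<close>

lemma superlinear_doubling_blowup:
  fixes F :: "real \<Rightarrow> real"
  assumes "p > 1" "a > 0" "K > 0" "\<tau> > 0" "b \<ge> 0"
    and h: "h\<^sup>2 = 2 / K * a powr (1 - p)" "h \<ge> 0"
    and fits: "h / (1 - 2 powr (- (p - 1) / 2)) \<le> b"
    and start: "a \<le> F \<tau>"
    and step: "\<And>s r. \<tau> \<le> s \<Longrightarrow> s \<le> r \<Longrightarrow> r \<le> \<tau> + b \<Longrightarrow>
      F s + K * F s powr p * (r - s)\<^sup>2 / 2 \<le> F r"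
  shows False
proof -
  define q where "q = 2 powr (- (p - 1) / 2)"
  have q: "0 < q" "q < 1"
    using \<open>p > 1\<close> by (auto simp: q_def intro: powr_less_one)
  have q2: "q\<^sup>2 = 2 powr (1 - p)"
    by (simp add: q_def power2_eq_square flip: powr_add)
  \<comment> \<open>Partial sums of the geometric series of doubling times; its total h / (1 - q)
    stays within b by \<open>fits\<close>.\<close>
  define s where "s j = \<tau> + h * (1 - q ^ j) / (1 - q)" for j :: nat
  have s_Suc: "s (Suc j) - s j = h * q ^ j" for j
  proof -
    have "s (Suc j) - s j = h * q ^ j * (1 - q) / (1 - q)"
      by (simp add: s_def algebra_simps flip: diff_divide_distrib)
    then show ?thesis using q by simp
  qed
  have s_ge: "\<tau> \<le> s j" and s_mono: "s j \<le> s (Suc j)" for j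
    using q h s_Suc[of j] by (auto simp: s_def power_le_one intro!: divide_nonneg_nonneg mult_nonneg_nonneg) (smt (verit) mult_nonneg_nonneg zero_le_power)
  have s_le: "s j \<le> \<tau> + b" for j
  proof -
    have "h * (1 - q ^ j) / (1 - q) \<le> h * 1 / (1 - q)"
      using q h by (intro divide_right_mono mult_left_mono) auto
    then show ?thesis using fits by (simp add: s_def q_def)
  qed
  have F_s: "2 ^ j * a \<le> F (s j)" for j
  proof (induction j)
    case 0
    then show ?case using start by (simp add: s_def)
  next
    case (Suc j)
    \<comment> \<open>The value of h makes the quadratic gain over time h q^j exactly one more copy
      of the current level: the factor (2^j)^p is reduced to 2^j by q^(2j) = (2^j)^(1-p).\<close>
    have "K * (2 ^ j * a) powr p * (h * q ^ j)\<^sup>2 / 2 = 2 ^ j * a"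
    proof -
      have *: "(2 ^ j) powr p * (q ^ j)\<^sup>2 = (2::real) ^ j"
      proof -
        have "(q ^ j)\<^sup>2 = (2 powr (1 - p)) ^ j"
          unfolding q2[symmetric] power_mult[symmetric] by (simp add: mult.commute)
        also have "\<dots> = (2 powr real j) powr (1 - p)"
          by (simp add: powr_powr powr_power mult.commute)
        also have "\<dots> = (2 ^ j) powr (1 - p)"
          by (simp add: powr_realpow)
        finally have "(q ^ j)\<^sup>2 = (2 ^ j) powr (1 - p)" .
        then show ?thesis by (simp flip: powr_add)
      qed
      have "K * (2 ^ j * a) powr p * (h * q ^ j)\<^sup>2 / 2
          = (K * h\<^sup>2 / 2 * a powr p) * ((2 ^ j) powr p * (q ^ j)\<^sup>2)"
        using \<open>a > 0\<close> by (simp add: powr_mult power_mult_distrib)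
      also have "K * h\<^sup>2 / 2 * a powr p = a"
        using \<open>K > 0\<close> \<open>a > 0\<close> by (simp add: h flip: powr_add)
      finally show ?thesis using * by (simp add: mult.commute)
    qed
    moreover have "K * (2 ^ j * a) powr p * (h * q ^ j)\<^sup>2 / 2 \<le> K * F (s j) powr p * (h * q ^ j)\<^sup>2 / 2"
      using Suc \<open>a > 0\<close> \<open>K > 0\<close> \<open>p > 1\<close>
      by (intro divide_right_mono mult_right_mono mult_left_mono powr_mono2) auto
    ultimately show ?case
      using step[OF s_ge s_mono s_le, of j] Suc by (simp add: s_Suc)
  qed
  \<comment> \<open>F does not decrease from \<open>s j\<close> to the fixed time \<tau> + b, so a
    single real number dominates every level 2^j a.\<close>
  have F_end: "2 ^ j * a \<le> F (\<tau> + b)" for j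
  proof -
    have "0 \<le> K * F (s j) powr p * (\<tau> + b - s j)\<^sup>2 / 2"
      using \<open>K > 0\<close> by simp
    then show ?thesis
      using step[OF s_ge s_le[of j]] F_s[of j] by fastforce
  qed
  obtain j where "F (\<tau> + b) / a < 2 ^ j"
    using real_arch_pow[of 2] by auto
  then show False
    using F_end[of j] \<open>a > 0\<close> by (simp add: field_simps)
qed

text \<open>Only the window [\<tau>, 2\<tau>] is used: for \<tau> \<ge> L one has 2 (r + L) \<le>
  6\<tau> there, so the coefficient is at least the constant c (6\<tau>)^(1-p), and linear growth
  supplies the starting level a \<tau> for doubling. Powers of \<tau> cancel in the doubling time,
  which is therefore a constant times a^(-(p-1)/2).\<close>

lemma lifespan_of_integral_inequality:
  fixes c L p :: real
  assumes "p > 1" "c > 0" "L > 0"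
  shows "\<exists>C>0. \<forall>a T F. 0 < a \<and> a \<le> 1 \<and> (\<forall>s. 0 \<le> s \<and> s < T \<longrightarrow> a * s \<le> F s) \<and>
      (\<forall>s r. 0 \<le> s \<and> s \<le> r \<and> r < T \<longrightarrow>
         F s + c * (2 * (r + L)) powr (1 - p) * F s powr p * (r - s)\<^sup>2 / 2 \<le> F r) \<longrightarrow>
      T \<le> C * a powr (- (p - 1) / 2)"
proof -
  define q where "q = 2 powr (- (p - 1) / 2)"
  have q: "0 < q" "q < 1"
    using \<open>p > 1\<close> by (auto simp: q_def intro: powr_less_one)
  \<comment> \<open>Inserting K = c (6\<tau>)^(1-p) and the level a \<tau> into h^2 = 2/K (a
    \<tau>)^(1-p) gives h = H e with e = a^(-(p-1)/2).\<close>
  define H where "H = sqrt (2 / c * 6 powr (p - 1))"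
  \<comment> \<open>The entry L ensures \<tau> = D e \<ge> L, since a \<le> 1 gives e \<ge> 1; the
    other entry keeps the total doubling time H e / (1 - q) below \<tau>.\<close>
  define D where "D = max L (H / (1 - q))"
  have "D > 0" using assms by (simp add: D_def)
  have bound: "T \<le> 2 * D * a powr (- (p - 1) / 2)"
    if hyps: "0 < a \<and> a \<le> 1 \<and> (\<forall>s. 0 \<le> s \<and> s < T \<longrightarrow> a * s \<le> F s) \<and>
      (\<forall>s r. 0 \<le> s \<and> s \<le> r \<and> r < T \<longrightarrow>
         F s + c * (2 * (r + L)) powr (1 - p) * F s powr p * (r - s)\<^sup>2 / 2 \<le> F r)"
    for a T :: real and F :: "real \<Rightarrow> real"
  proof (rule ccontr)
    have a: "0 < a" "a \<le> 1"
      and lin: "\<And>s. 0 \<le> s \<Longrightarrow> s < T \<Longrightarrow> a * s \<le> F s"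
      and step: "\<And>s r. 0 \<le> s \<Longrightarrow> s \<le> r \<Longrightarrow> r < T \<Longrightarrow>
         F s + c * (2 * (r + L)) powr (1 - p) * F s powr p * (r - s)\<^sup>2 / 2 \<le> F r"
      using hyps by blast+
    define e where "e = a powr (- (p - 1) / 2)"
    define \<tau> where "\<tau> = D * e"
    assume "\<not> T \<le> 2 * D * a powr (- (p - 1) / 2)"
    then have T: "2 * \<tau> < T" by (simp add: \<tau>_def e_def)
    have e: "e \<ge> 1"
      using a \<open>p > 1\<close> unfolding e_def using powr_mono2'[of "- (p - 1) / 2" a 1] by simp
    then have \<tau>: "L \<le> \<tau>" "H * e / (1 - q) \<le> \<tau>" "\<tau> > 0"
      using \<open>D > 0\<close> \<open>L > 0\<close> mult_mono[of L D 1 e] mult_right_mono[of "H / (1 - q)" D e]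
      by (auto simp: \<tau>_def D_def)
    define K where "K = c * (6 * \<tau>) powr (1 - p)"
    have "K > 0" using \<open>c > 0\<close> \<open>\<tau> > 0\<close> by (simp add: K_def)
    have e2: "e\<^sup>2 = a powr (1 - p)"
      by (simp add: e_def power2_eq_square flip: powr_add)
    have "2 / K * (a * \<tau>) powr (1 - p) = (2 / c * 6 powr (p - 1)) * a powr (1 - p)"
      using a \<open>\<tau> > 0\<close> \<open>c > 0\<close> by (simp add: K_def powr_mult powr_diff field_simps)
    then have H: "(H * e)\<^sup>2 = 2 / K * (a * \<tau>) powr (1 - p)"
      using \<open>c > 0\<close> by (simp add: H_def power_mult_distrib e2)
    have "0 \<le> H * e"
      using e \<open>c > 0\<close> by (simp add: H_def)
    show False
    proof (rule superlinear_doubling_blowup[where F = F and \<tau> = \<tau> and b = \<tau> and a = "a * \<tau>" and K = K, OF \<open>p > 1\<close>])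
      show "H * e / (1 - 2 powr (- (p - 1) / 2)) \<le> \<tau>"
        using \<tau> by (simp add: q_def)
      show "a * \<tau> \<le> F \<tau>" using lin T \<open>\<tau> > 0\<close> by simp
      fix s r assume sr: "\<tau> \<le> s" "s \<le> r" "r \<le> \<tau> + \<tau>"
      have "(6 * \<tau>) powr (1 - p) \<le> (2 * (r + L)) powr (1 - p)"
        using sr \<tau> \<open>p > 1\<close> \<open>L > 0\<close> by (intro powr_mono2') auto
      then have "K * F s powr p * (r - s)\<^sup>2 / 2 \<le> c * (2 * (r + L)) powr (1 - p) * F s powr p * (r - s)\<^sup>2 / 2"
        unfolding K_def using \<open>c > 0\<close>
        by (intro divide_right_mono mult_right_mono mult_left_mono) auto
      then show "F s + K * F s powr p * (r - s)\<^sup>2 / 2 \<le> F r"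
        using step[of s r] sr \<tau> T by linarith
    qed (use a \<open>\<tau> > 0\<close> \<open>K > 0\<close> H \<open>0 \<le> H * e\<close> in auto)
  qed
  then show ?thesis
    by (intro exI[of _ "2 * D"] conjI allI impI) (use \<open>D > 0\<close> in simp, erule bound)
qed

text \<open>Formally V' + d V \<ge> k |F|^p, hence (m V)' \<ge> m k |F|^p with the integrating
  factor m, and further integration gives both conclusions. As V is merely continuous, the
  inequality enters in integrated form, at positive times only.\<close>

lemma damped_second_order_inequality:
  fixes F V d k m :: "real \<Rightarrow> real" and b p :: real
  assumes "b > 0" "p > 1"
    and cV: "continuous_on {0..b} V" and cd: "continuous_on {0..b} d" and ck: "continuous_on {0..b} k"
    and dF: "\<And>t. t \<in> {0..b} \<Longrightarrow> (F has_real_derivative V t) (at t within {0..b})"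
    and ineq: "\<And>s r. 0 < s \<Longrightarrow> s < r \<Longrightarrow> r \<le> b \<Longrightarrow>
       integral {s..r} (\<lambda>t. k t * \<bar>F t\<bar> powr p) \<le> V r - V s + integral {s..r} (\<lambda>t. d t * V t)"
    and dm: "\<And>t. t \<in> {0..b} \<Longrightarrow> (m has_real_derivative d t * m t) (at t within {0..b})"
    and d_nonneg: "\<And>t. t \<in> {0..b} \<Longrightarrow> 0 \<le> d t"
    and k_nonneg: "\<And>t. t \<in> {0..b} \<Longrightarrow> 0 \<le> k t"
    and k_anti: "\<And>s t. 0 \<le> s \<Longrightarrow> s \<le> t \<Longrightarrow> t \<le> b \<Longrightarrow> k t \<le> k s"
    and m: "\<And>t. t \<in> {0..b} \<Longrightarrow> m0 \<le> m t \<and> m t \<le> 1" "m0 > 0"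
    and init: "0 \<le> F 0" "0 < V 0"
  shows "\<And>t. t \<in> {0..b} \<Longrightarrow> m0 * V 0 * t \<le> F t"
    and "\<And>s r. 0 \<le> s \<Longrightarrow> s \<le> r \<Longrightarrow> r \<le> b \<Longrightarrow>
       F s + m0 * k r * F s powr p * (r - s)\<^sup>2 / 2 \<le> F r"
proof -
  have cF: "continuous_on {0..b} F"
    using dF by (rule DERIV_continuous_on)
  define \<phi> where "\<phi> t = k t * \<bar>F t\<bar> powr p - d t * V t" for t
  have cont: "continuous_on {0..b} (\<lambda>t. k t * \<bar>F t\<bar> powr p)" "continuous_on {0..b} (\<lambda>t. d t * V t)"
    "continuous_on {0..b} \<phi>"
    unfolding \<phi>_def using \<open>p > 1\<close>
    by (intro continuous_intros continuous_on_powr' cF cV cd ck; simp)+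
  define Q where "Q t = integral {0..t} \<phi>" for t
  have dQ: "(Q has_real_derivative \<phi> t) (at t within {0..b})" if "t \<in> {0..b}" for t
    unfolding Q_def using integral_has_real_derivative[OF cont(3) that] .
  have cQ: "continuous_on {0..b} Q"
    using dQ by (rule DERIV_continuous_on)
  \<comment> \<open>Here \<open>\<phi>\<close> is the formal lower bound for V', and monotonicity of
    Z is its integrated form.\<close>
  define Z where "Z t = V t - Q t" for t
  have cZ: "continuous_on {0..b} Z"
    unfolding Z_def by (intro continuous_intros cV cQ)
  have Z_mono_pos: "Z s \<le> Z r" if "0 < s" "s \<le> r" "r \<le> b" for s r
  proof (cases "s < r")
    case True
    have sub: "{s..r} \<subseteq> {0..b}" "{0..r} \<subseteq> {0..b}" using that by auto
    have "\<phi> integrable_on {0..r}"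
      using cont(3) sub by (intro integrable_continuous_real) (rule continuous_on_subset)
    then have "Q r - Q s = integral {s..r} \<phi>"
      unfolding Q_def using Henstock_Kurzweil_Integration.integral_combine[of 0 s r \<phi>] that by simp
    also have "\<dots> = integral {s..r} (\<lambda>t. k t * \<bar>F t\<bar> powr p) - integral {s..r} (\<lambda>t. d t * V t)"
      unfolding \<phi>_def using cont(1,2) sub
      by (intro Henstock_Kurzweil_Integration.integral_diff integrable_continuous_real)
         (auto intro: continuous_on_subset)
    finally show ?thesis using ineq[OF that(1) True that(3)] by (simp add: Z_def)
  qed (use that in auto)
  \<comment> \<open>The hypothesis omits s = 0; right continuity of Z at 0 closes the gap.\<close>
  have Z_mono: "Z s \<le> Z r" if "0 \<le> s" "s \<le> r" "r \<le> b" for s r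
  proof (cases "s = 0 \<and> r > 0")
    case True
    have "(Z \<longlongrightarrow> Z 0) (at 0 within {0..b})"
      using cZ \<open>b > 0\<close> by (auto simp: continuous_on_def)
    then have "(Z \<longlongrightarrow> Z 0) (at_right 0)"
      using \<open>b > 0\<close> by (simp add: at_within_Icc_at_right)
    moreover have "\<forall>\<^sub>F t in at_right 0. Z t \<le> Z r"
      using True that by (intro eventually_at_rightI[of 0 r] Z_mono_pos) auto
    ultimately show ?thesis
      using True by (auto intro: tendsto_upperbound)
  next
    case False
    then have "0 < s \<or> s = r" using that by (cases "s = 0") auto
    then show ?thesis using that Z_mono_pos by auto
  qed
  text \<open>Freezing the nondecreasing \<open>Z\<close> at the right end point \<open>r\<close> makes the product
    differentiable although \<open>V\<close> need not be.\<close>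
  have weighted: "m s * V s + m0 * \<kappa> * (r - s) \<le> m r * V r"
    if sr: "0 \<le> s" "s \<le> r" "r \<le> b" and \<kappa>: "0 \<le> \<kappa>" "\<And>t. t \<in> {s..r} \<Longrightarrow> \<kappa> \<le> k t * \<bar>F t\<bar> powr p" for s r \<kappa>
  proof -
    let ?J = "\<lambda>t. m t * (Q t + Z r) - m0 * \<kappa> * t"
    let ?J' = "\<lambda>t. d t * m t * (Q t + Z r) + \<phi> t * m t - m0 * \<kappa>"
    have "?J s \<le> ?J r"
    proof (rule nondecreasing_of_derivative_within[where A = "{0..b}" and f = ?J and f' = ?J'])
      fix t assume t: "t \<in> {s..r}"
      then have tb: "t \<in> {0..b}" using sr by auto
      show "(?J has_real_derivative ?J' t) (at t within {0..b})"
        using dm[OF tb] dQ[OF tb] by (auto intro!: derivative_eq_intros)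
      have "m0 * \<kappa> \<le> m t * (k t * \<bar>F t\<bar> powr p)"
        using m(1)[OF tb] m(2) \<kappa> t by (intro mult_mono) auto
      moreover have "0 \<le> d t * m t * (Z r - Z t)"
        using Z_mono[of t r] d_nonneg[OF tb] m(1)[OF tb] m(2) t sr by (intro mult_nonneg_nonneg) auto
      \<comment> \<open>Substituting Q t = V t - Z t cancels the two terms in d V.\<close>
      moreover have "?J' t = d t * m t * (Z r - Z t) + m t * (k t * \<bar>F t\<bar> powr p) - m0 * \<kappa>"
        by (simp add: \<phi>_def Z_def algebra_simps)
      ultimately show "0 \<le> ?J' t" by linarith
    qed (use sr in auto)
    moreover have "m s * Z s \<le> m s * Z r"
      using Z_mono[OF sr] m(1)[of s] m(2) sr by (intro mult_left_mono) auto
    ultimately show ?thesis by (simp add: Z_def algebra_simps)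
  qed
  have V_ge: "m0 * V 0 \<le> m t * V t" if "t \<in> {0..b}" for t
  proof -
    \<comment> \<open>The choice \<kappa> = 0 gives positivity of V before any monotonicity of F is
      known.\<close>
    have "m 0 * V 0 + m0 * 0 * (t - 0) \<le> m t * V t"
      using that k_nonneg by (intro weighted) auto
    moreover have "m0 * V 0 \<le> m 0 * V 0"
      using m(1)[of 0] init that by (intro mult_right_mono) auto
    ultimately show ?thesis by simp
  qed
  have V_pos: "0 < V t" and mV_le: "m t * V t \<le> V t" if "t \<in> {0..b}" for t
  proof -
    have "0 < m0 * V 0" using m(2) init by simp
    then have "0 < m t * V t" using V_ge[OF that] by linarith
    moreover have "0 < m t" using m(1)[OF that] m(2) by linarith
    ultimately show "0 < V t" by (simp add: zero_less_mult_iff)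
    then show "m t * V t \<le> V t" using m(1)[OF that] m(2) by (intro mult_left_le_one_le) auto
  qed
  have lin: "F s + m0 * V 0 * (r - s) \<le> F r" if sr: "0 \<le> s" "s \<le> r" "r \<le> b" for s r
  proof -
    have "F s - m0 * V 0 * s \<le> F r - m0 * V 0 * r"
    proof (rule nondecreasing_of_derivative_within[where A = "{0..b}" and f = "\<lambda>t. F t - m0 * V 0 * t"
          and f' = "\<lambda>t. V t - m0 * V 0"])
      fix t assume t: "t \<in> {s..r}"
      then have tb: "t \<in> {0..b}" using sr by auto
      show "((\<lambda>t. F t - m0 * V 0 * t) has_real_derivative V t - m0 * V 0) (at t within {0..b})"
        using dF[OF tb] by (auto intro!: derivative_eq_intros)
      show "0 \<le> V t - m0 * V 0" using V_ge[OF tb] mV_le[OF tb] by simp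
    qed (use sr in auto)
    then show ?thesis by (simp add: algebra_simps)
  qed
  show lin0: "m0 * V 0 * t \<le> F t" if "t \<in> {0..b}" for t
    using lin[of 0 t] init that by simp
  fix s r assume sr: "0 \<le> s" "s \<le> r" "r \<le> b"
  have "0 \<le> F s"
    using lin0[of s] sr m(2) init by (smt (verit) atLeastAtMost_iff mult_nonneg_nonneg)
  \<comment> \<open>A lower bound for k |F|^p on [s, r]: k is smallest at r because it is
    nonincreasing, F at s because V > 0.\<close>
  define \<kappa> where "\<kappa> = k r * F s powr p"
  have "0 \<le> \<kappa>" using k_nonneg[of r] sr by (simp add: \<kappa>_def)
  have \<kappa>_le: "\<kappa> \<le> k t * \<bar>F t\<bar> powr p" if "t \<in> {s..r}" for t
  proof -
    have "0 \<le> m0 * V 0 * (t - s)" using m(2) init that by auto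
    then have "F s \<le> F t" using lin[of s t] that sr by auto
    then show ?thesis unfolding \<kappa>_def
      using k_anti[of t r] k_nonneg[of t] that sr \<open>0 \<le> F s\<close> \<open>p > 1\<close>
      by (intro mult_mono powr_mono2) auto
  qed
  \<comment> \<open>As m \<le> 1, V t is at least m0 \<kappa> (t - s), so subtracting the parabola
    with this slope leaves a nondecreasing function.\<close>
  have "F s - m0 * \<kappa> * (s - s)\<^sup>2 / 2 \<le> F r - m0 * \<kappa> * (r - s)\<^sup>2 / 2"
  proof (rule nondecreasing_of_derivative_within[where A = "{0..b}"
        and f = "\<lambda>t. F t - m0 * \<kappa> * (t - s)\<^sup>2 / 2" and f' = "\<lambda>t. V t - m0 * \<kappa> * (t - s)"])
    fix t assume t: "t \<in> {s..r}"
    then have tb: "t \<in> {0..b}" using sr by auto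
    show "((\<lambda>t. F t - m0 * \<kappa> * (t - s)\<^sup>2 / 2) has_real_derivative V t - m0 * \<kappa> * (t - s)) (at t within {0..b})"
      using dF[OF tb] by (auto intro!: derivative_eq_intros)
    have "m s * V s + m0 * \<kappa> * (t - s) \<le> m t * V t"
      using t sr \<open>0 \<le> \<kappa>\<close> \<kappa>_le by (intro weighted) auto
    moreover have "0 \<le> m s * V s"
      using V_pos[of s] m(1)[of s] m(2) sr by (auto intro!: mult_nonneg_nonneg)
    ultimately show "0 \<le> V t - m0 * \<kappa> * (t - s)" using mV_le[OF tb] by simp
  qed (use sr in auto)
  then show "F s + m0 * k r * F s powr p * (r - s)\<^sup>2 / 2 \<le> F r"
    by (simp add: \<kappa>_def mult.assoc)
qed

section \<open>Square integrable functions and slices of functions of two variables\<close>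

lemma L2_mult_integrable:
  assumes "f \<in> L2" "g \<in> L2"
  shows "integrable lebesgue (\<lambda>x. f x * g x)"
proof (rule Bochner_Integration.integrable_bound)
  show "integrable lebesgue (\<lambda>x. (f x)\<^sup>2 + (g x)\<^sup>2)"
    using assms by (auto simp: L2_def)
  show "(\<lambda>x. f x * g x) \<in> borel_measurable lebesgue"
    using assms by (intro borel_measurable_times) (auto simp: L2_def)
  show "AE x in lebesgue. norm (f x * g x) \<le> norm ((f x)\<^sup>2 + (g x)\<^sup>2)"
  proof (rule AE_I2)
    fix x
    have "0 \<le> (\<bar>f x\<bar> - \<bar>g x\<bar>)\<^sup>2" by simp
    then have "2 * \<bar>f x * g x\<bar> \<le> (f x)\<^sup>2 + (g x)\<^sup>2"
      by (simp add: power2_diff abs_mult)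
    then show "norm (f x * g x) \<le> norm ((f x)\<^sup>2 + (g x)\<^sup>2)"
      unfolding real_norm_def by linarith
  qed
qed

lemma L2_add: "f \<in> L2 \<Longrightarrow> g \<in> L2 \<Longrightarrow> (\<lambda>x. f x + g x) \<in> L2"
  using L2_mult_integrable[of f g] by (auto simp: L2_def power2_sum mult.assoc)

lemma L2_cmult: "f \<in> L2 \<Longrightarrow> (\<lambda>x. c * f x) \<in> L2"
  by (auto simp: L2_def power_mult_distrib)

lemma L2_diff: "f \<in> L2 \<Longrightarrow> g \<in> L2 \<Longrightarrow> (\<lambda>x. f x - g x) \<in> L2"
  using L2_add[OF _ L2_cmult[of g "-1"], of f] by simp

lemma L2_norm_nonneg: "0 \<le> L2_norm f"
  by (simp add: L2_norm_def)

text \<open>The integral of (f + c g)^2 is a nonnegative quadratic in c, so its discriminant is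
  nonpositive.\<close>

lemma L2_Cauchy_Schwarz:
  assumes f: "f \<in> L2" and g: "g \<in> L2"
  shows "\<bar>LINT x|lebesgue. f x * g x\<bar> \<le> L2_norm f * L2_norm g"
proof -
  define A B I where "A = (LINT x|lebesgue. (f x)\<^sup>2)" and "B = (LINT x|lebesgue. (g x)\<^sup>2)"
    and "I = (LINT x|lebesgue. f x * g x)"
  have [simp]: "A \<ge> 0" "B \<ge> 0" by (simp_all add: A_def B_def)
  have q: "0 \<le> A + 2 * c * I + c\<^sup>2 * B" for c
  proof -
    have "0 \<le> (LINT x|lebesgue. (f x + c * g x)\<^sup>2)" by simp
    also have "\<dots> = (LINT x|lebesgue. (f x)\<^sup>2 + 2 * c * (f x * g x) + c\<^sup>2 * (g x)\<^sup>2)"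
      by (intro Bochner_Integration.integral_cong) (auto simp: power2_sum power_mult_distrib algebra_simps)
    also have "\<dots> = A + 2 * c * I + c\<^sup>2 * B"
      using f g L2_mult_integrable[OF f g] by (simp add: A_def B_def I_def L2_def)
    finally show ?thesis .
  qed
  have "I\<^sup>2 \<le> A * B"
  proof (cases "B = 0")
    case True
    have "I = 0"
    proof (rule ccontr)
      assume "I \<noteq> 0"
      \<comment> \<open>With B = 0 the quadratic is affine in c, and at this c it equals -1.\<close>
      then show False using q[of "- (A + 1) / (2 * I)"] True by (simp add: field_simps)
    qed
    then show ?thesis using True by simp
  next
    case False
    then have "B > 0" using \<open>B \<ge> 0\<close> by linarith
    then have "0 \<le> (A + 2 * (- I / B) * I + (- I / B)\<^sup>2 * B) * B"
      using q[of "- I / B"] by (intro mult_nonneg_nonneg) auto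
    then show ?thesis using \<open>B > 0\<close> by (simp add: field_simps power2_eq_square)
  qed
  then have "sqrt (I\<^sup>2) \<le> sqrt (A * B)" by (rule real_sqrt_le_mono)
  then show ?thesis
    by (simp add: L2_norm_def A_def B_def I_def real_sqrt_mult)
qed

lemma C_L2_pairing_continuous:
  assumes v: "C_L2 I v" and h: "h \<in> L2"
  shows "continuous_on I (\<lambda>t. LINT x|lebesgue. v t x * h x)"
  unfolding continuous_on_def
proof
  fix t assume t: "t \<in> I"
  have "((\<lambda>s. L2_norm (\<lambda>x. v s x - v t x) * L2_norm h) \<longlongrightarrow> 0) (at t within I)"
    using v t by (auto simp: C_L2_def intro: tendsto_mult_left_zero)
  moreover have "\<forall>\<^sub>F s in at t within I. norm ((LINT x|lebesgue. v s x * h x) - (LINT x|lebesgue. v t x * h x))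
      \<le> L2_norm (\<lambda>x. v s x - v t x) * L2_norm h"
  proof (rule eventually_at_filter[THEN iffD2], rule always_eventually, safe)
    fix s assume s: "s \<in> I"
    have L: "v s \<in> L2" "v t \<in> L2" using v s t by (auto simp: C_L2_def)
    have "(LINT x|lebesgue. v s x * h x) - (LINT x|lebesgue. v t x * h x)
        = (LINT x|lebesgue. (v s x - v t x) * h x)"
      using L h by (simp add: L2_mult_integrable left_diff_distrib)
    then show "norm ((LINT x|lebesgue. v s x * h x) - (LINT x|lebesgue. v t x * h x))
      \<le> L2_norm (\<lambda>x. v s x - v t x) * L2_norm h"
      using L2_Cauchy_Schwarz[OF L2_diff[OF L] h] by simp
  qed
  ultimately have "((\<lambda>s. (LINT x|lebesgue. v s x * h x) - (LINT x|lebesgue. v t x * h x)) \<longlongrightarrow> 0) (at t within I)"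
    by (rule Lim_null_comparison[rotated])
  then show "((\<lambda>s. LINT x|lebesgue. v s x * h x) \<longlongrightarrow> (LINT x|lebesgue. v t x * h x)) (at t within I)"
    by (simp add: LIM_zero_iff)
qed

text \<open>By Cauchy-Schwarz, pairing with h is bounded on L^2, so it carries L^2 convergence of
  the difference quotients to real convergence. With a cutoff as h this yields F' = V.\<close>

lemma C1_L2_pairing_has_derivative:
  assumes v: "C1_L2_with I v w" and h: "h \<in> L2" and t: "t \<in> I"
  shows "((\<lambda>t. LINT x|lebesgue. v t x * h x) has_real_derivative (LINT x|lebesgue. w t x * h x)) (at t within I)"
proof -
  let ?D = "\<lambda>s. ((LINT x|lebesgue. v s x * h x) - (LINT x|lebesgue. v t x * h x)) / (s - t)"
  have "((\<lambda>s. L2_norm (\<lambda>x. (v s x - v t x) / (s - t) - w t x) * L2_norm h) \<longlongrightarrow> 0) (at t within I)"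
    using v t by (auto simp: C1_L2_with_def intro: tendsto_mult_left_zero)
  moreover have "\<forall>\<^sub>F s in at t within I. norm (?D s - (LINT x|lebesgue. w t x * h x))
      \<le> L2_norm (\<lambda>x. (v s x - v t x) / (s - t) - w t x) * L2_norm h"
  proof (rule eventually_at_filter[THEN iffD2], rule always_eventually, safe)
    fix s assume s: "s \<in> I" "s \<noteq> t"
    have L: "v s \<in> L2" "v t \<in> L2" "w t \<in> L2"
      using v s t by (auto simp: C_L2_def C1_L2_with_def)
    have L': "(\<lambda>x. (v s x - v t x) / (s - t) - w t x) \<in> L2"
      using L2_diff[OF L2_cmult[OF L2_diff[OF L(1,2)], of "1 / (s - t)"] L(3)] by simp
    have "(LINT x|lebesgue. ((v s x - v t x) / (s - t) - w t x) * h x)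
        = (LINT x|lebesgue. (1 / (s - t)) * (v s x * h x - v t x * h x) - w t x * h x)"
      by (intro Bochner_Integration.integral_cong) (auto simp: algebra_simps diff_divide_distrib)
    also have "\<dots> = ?D s - (LINT x|lebesgue. w t x * h x)"
      using L h by (subst Bochner_Integration.integral_diff) (auto simp: L2_mult_integrable)
    finally show "norm (?D s - (LINT x|lebesgue. w t x * h x))
      \<le> L2_norm (\<lambda>x. (v s x - v t x) / (s - t) - w t x) * L2_norm h"
      using L2_Cauchy_Schwarz[OF L' h] by simp
  qed
  ultimately have "((\<lambda>s. ?D s - (LINT x|lebesgue. w t x * h x)) \<longlongrightarrow> 0) (at t within I)"
    by (rule Lim_null_comparison[rotated])
  then show ?thesis
    by (simp add: LIM_zero_iff has_field_derivative_iff)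
qed

text \<open>Lebesgue measure on the product space is a completion, so the exceptional set is first
  enclosed in a Borel null set, to which Fubini for \<open>lborel\<close> applies. The variables are
  then exchanged because slices at fixed t are wanted.\<close>

lemma AE_lebesgue_prod:
  fixes P :: "'a::euclidean_space \<times> 'b::euclidean_space \<Rightarrow> bool"
  assumes "AE z in lebesgue. P z"
  shows "AE t in lebesgue. AE x in lebesgue. P (x, t)"
proof -
  have "AE z in lborel. P z"
    using assms by (simp add: AE_completion_iff)
  then obtain N where "N \<in> null_sets (lborel :: ('a \<times> 'b) measure)" and N2: "{z. \<not> P z} \<subseteq> N"
    unfolding eventually_ae_filter by auto
  then have N: "N \<in> null_sets (lborel \<Otimes>\<^sub>M lborel)"
    by (simp only: lborel_prod)
  then have "AE z in lborel \<Otimes>\<^sub>M lborel. z \<notin> N"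
    by (rule AE_not_in)
  then have "AE x in lborel. AE t in lborel. (x, t) \<notin> N"
    by (rule lborel_pair.AE_pair)
  moreover have "{z \<in> space (lborel \<Otimes>\<^sub>M lborel). (fst z, snd z) \<notin> N} = space (lborel \<Otimes>\<^sub>M lborel) - N"
    by auto
  then have "{z \<in> space (lborel \<Otimes>\<^sub>M lborel). (fst z, snd z) \<notin> N} \<in> sets (lborel \<Otimes>\<^sub>M lborel)"
    using sets.compl_sets[OF null_setsD2[OF N]] by (simp only:)
  ultimately have "AE t in lborel. AE x in lborel. (x, t) \<notin> N"
    using lborel_pair.AE_commute[of "\<lambda>x t. (x, t) \<notin> N"] by blast
  moreover have "(x, t) \<notin> N \<Longrightarrow> P (x, t)" for x t
    using N2 by auto
  ultimately show ?thesis
    unfolding AE_completion_iff by (auto elim!: eventually_mono)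
qed

text \<open>Fubini is applied to a Borel representative; on almost every slice it agrees with f
  almost everywhere, which carries integrability and the inner integrals back to f.\<close>

lemma integrable_lebesgue_prod_slice:
  fixes f :: "'a::euclidean_space \<times> 'b::euclidean_space \<Rightarrow> real"
  assumes f: "integrable lebesgue f"
  shows "AE t in lebesgue. integrable lebesgue (\<lambda>x. f (x, t))"
    and "integrable lebesgue (\<lambda>t. LINT x|lebesgue. f (x, t))"
proof -
  obtain f' where f': "f' \<in> borel_measurable lborel" "AE z in lborel. f z = f' z"
    using completion_ex_borel_measurable_real[of f lborel] f by auto
  have "integrable lebesgue f'"
    by (rule integrable_cong_AE_imp[OF f measurable_completion[OF f'(1)]])
      (use f'(2) in \<open>simp add: AE_completion_iff\<close>)
  then have "integrable lborel f'"
    using f' by (simp add: integrable_completion)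
  then have int: "integrable (lborel \<Otimes>\<^sub>M lborel) (case_prod (\<lambda>x t. f' (x, t)))"
    by (simp add: lborel_prod)
  have ae: "AE t in lebesgue. AE x in lebesgue. f (x, t) = f' (x, t)"
    using f'(2) by (intro AE_lebesgue_prod) (simp add: AE_completion_iff)
  have m: "(\<lambda>x. f' (x, t)) \<in> borel_measurable lborel" for t
    using f'(1) by measurable
  have 1: "AE t in lebesgue. integrable lebesgue (\<lambda>x. f' (x, t))"
    using lborel_pair.AE_integrable_snd[OF int] m by (simp add: AE_completion_iff integrable_completion)
  have 2: "integrable lebesgue (\<lambda>t. LINT x|lebesgue. f' (x, t))"
    using lborel_pair.integrable_snd[OF int] m by (simp add: integrable_completion integral_completion)
  have ae': "AE t in lebesgue. integrable lebesgue (\<lambda>x. f (x, t)) \<and>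
      (LINT x|lebesgue. f' (x, t)) = (LINT x|lebesgue. f (x, t))"
    using ae 1
  proof eventually_elim
    case (elim t)
    have e: "AE x in lebesgue. f' (x, t) = f (x, t)"
      using elim(1) by eventually_elim simp
    note m1 = borel_measurable_integrable[OF elim(2)]
    note m2 = borel_measurable_AE[OF m1 e]
    show ?case
      using integrable_cong_AE_imp[OF elim(2) m2 e] integral_cong_AE[OF m1 m2 e] by blast
  qed
  then show "AE t in lebesgue. integrable lebesgue (\<lambda>x. f (x, t))"
    by auto
  have e: "AE t in lebesgue. (LINT x|lebesgue. f' (x, t)) = (LINT x|lebesgue. f (x, t))"
    using ae' by eventually_elim simp
  show "integrable lebesgue (\<lambda>t. LINT x|lebesgue. f (x, t))"
    by (rule integrable_cong_AE_imp[OF 2 borel_measurable_AE[OF borel_measurable_integrable[OF 2] e] e])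
qed

section \<open>Truncation to bounded intervals and Jensen's inequality\<close>

lemma integrable_indicator_Icc:
  fixes a b :: real
  shows "integrable lebesgue (indicat_real {a..b})"
  by (rule integrable_real_indicator) (auto simp: emeasure_lborel_Icc_eq)

lemma L2_integrable_on_interval:
  assumes "f \<in> L2"
  shows "integrable lebesgue (\<lambda>x. indicator {a..b} x * f x)"
proof -
  have "(\<lambda>x. (indicat_real {a..b} x)\<^sup>2) = indicator {a..b}"
    by (auto simp: indicator_def)
  then have "indicator {a..b} \<in> L2"
    using borel_measurable_integrable[OF integrable_indicator_Icc] by (simp add: L2_def integrable_indicator_Icc)
  then show ?thesis
    using assms by (rule L2_mult_integrable)
qed

text \<open>The left-hand side is the tangent to a^p at m. The inequality is Young's with conjugate
  exponents p and p / (p - 1).\<close>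

lemma powr_ge_tangent:
  fixes a m p :: real
  assumes "0 \<le> a" "0 \<le> m" "1 < p"
  shows "p * m powr (p - 1) * a - (p - 1) * m powr p \<le> a powr p"
proof -
  have "a * m powr (p - 1) \<le> a powr p / p + (m powr (p - 1)) powr (p / (p - 1)) / (p / (p - 1))"
    using assms by (intro Youngs_inequality) (auto simp: field_simps)
  also have "(m powr (p - 1)) powr (p / (p - 1)) = m powr p"
    using assms by (simp add: powr_powr)
  finally have "p * (a * m powr (p - 1)) \<le> p * (a powr p / p + m powr p / (p / (p - 1)))"
    using assms by (intro mult_left_mono) auto
  also have "\<dots> = a powr p + (p - 1) * m powr p"
    using assms by (simp add: distrib_left)
  finally show ?thesis
    by (simp add: mult.commute mult.left_commute)
qed

text \<open>The tangent inequality at m, the absolute value of the mean of f, is integrated over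
  [-L, L], where the weight is 1; outside, a nonnegative weight suffices.\<close>

lemma Jensen_powr_interval:
  assumes f: "f \<in> L2" and L: "L > 0" and p: "p > 1"
    and supp: "AE x in lebesgue. L < \<bar>x\<bar> \<longrightarrow> f x = 0"
    and h: "\<And>x. 0 \<le> h x" "\<And>x. \<bar>x\<bar> \<le> L \<Longrightarrow> h x = 1"
    and int: "integrable lebesgue (\<lambda>x. \<bar>f x\<bar> powr p * h x)"
  shows "(2 * L) powr (1 - p) * \<bar>LINT x|lebesgue. f x * h x\<bar> powr p \<le> (LINT x|lebesgue. \<bar>f x\<bar> powr p * h x)"
proof -
  define A where "A = (LINT x|lebesgue. f x * h x)"
  define m where "m = \<bar>A\<bar> / (2 * L)"
  have "0 \<le> m" using L by (simp add: m_def)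
  let ?I = "indicator {-L..L} :: real \<Rightarrow> real"
  have I: "integrable lebesgue ?I"
    by (rule integrable_indicator_Icc)
  have If: "integrable lebesgue (\<lambda>x. ?I x * f x)"
    using f by (rule L2_integrable_on_interval)
  then have Iaf: "integrable lebesgue (\<lambda>x. ?I x * \<bar>f x\<bar>)"
    using integrable_abs[OF If] by (simp add: abs_mult)
  have ae: "AE x in lebesgue. ?I x * f x = f x * h x"
    using supp by eventually_elim (auto simp: h(2) indicator_def)
  have mfh: "(\<lambda>x. f x * h x) \<in> borel_measurable lebesgue"
    by (rule borel_measurable_AE[OF borel_measurable_integrable[OF If] ae])
  have "A = (LINT x|lebesgue. ?I x * f x)"
    unfolding A_def
    by (rule integral_cong_AE[OF mfh borel_measurable_integrable[OF If]]) (use ae in eventually_elim, erule sym)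
  then have A_le: "\<bar>A\<bar> \<le> (LINT x|lebesgue. ?I x * \<bar>f x\<bar>)"
    using integral_abs_bound[of lebesgue "\<lambda>x. ?I x * f x"] by (simp add: abs_mult)
  have "(2 * L) powr (1 - p) * \<bar>A\<bar> powr p = 2 * L * m powr p"
    using L by (simp add: m_def powr_divide powr_diff)
  \<comment> \<open>The tangent at m evaluated at m itself, times the length 2 L. Its first term
    contains 2 L m = |A|, which \<open>A_le\<close> then enlarges to the integral of |f|.\<close>
  also have "\<dots> = p * m powr (p - 1) * (2 * L * m) - (p - 1) * m powr p * (2 * L)"
    using \<open>0 \<le> m\<close> by (cases "m = 0") (auto simp: powr_diff field_simps)
  also have "\<dots> \<le> p * m powr (p - 1) * (LINT x|lebesgue. ?I x * \<bar>f x\<bar>) - (p - 1) * m powr p * (2 * L)"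
    using A_le p L by (intro diff_right_mono mult_left_mono) (auto simp: m_def)
  also have "\<dots> = (LINT x|lebesgue. p * m powr (p - 1) * (?I x * \<bar>f x\<bar>) - (p - 1) * m powr p * ?I x)"
    using I Iaf L by simp
  also have "\<dots> \<le> (LINT x|lebesgue. \<bar>f x\<bar> powr p * h x)"
  proof (rule integral_mono_AE)
    show "AE x in lebesgue. p * m powr (p - 1) * (?I x * \<bar>f x\<bar>) - (p - 1) * m powr p * ?I x \<le> \<bar>f x\<bar> powr p * h x"
      using powr_ge_tangent[OF _ \<open>0 \<le> m\<close> p] h by (intro AE_I2) (auto simp: indicator_def)
  qed (use I Iaf int in auto)
  finally show ?thesis by (simp add: A_def)
qed

section \<open>Time slices and the support cone\<close>

lemma AE_lebesgue_imp_ex_greaterThanLessThan: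
  fixes a b :: real
  assumes "AE t in lebesgue. P t" "a < b"
  obtains t where "a < t" "t < b" "P t"
proof -
  have "\<exists>t\<in>{a<..<b}. P t"
  proof (rule ccontr)
    assume none: "\<not> (\<exists>t\<in>{a<..<b}. P t)"
    have "AE t in lborel. P t"
      using assms(1) by (simp add: AE_completion_iff)
    then obtain N where N: "N \<in> null_sets lborel" "{t. \<not> P t} \<subseteq> N"
      unfolding eventually_ae_filter by auto
    have "emeasure lborel {a<..<b} \<le> emeasure lborel N"
      using none N by (intro emeasure_mono) auto
    then show False
      using N \<open>a < b\<close> by (simp add: null_sets_def)
  qed
  with that show ?thesis by auto
qed

text \<open>Each point off the support has a neighbourhood on which u vanishes almost everywhere. By
  Lindelof countably many of these suffice, so the exceptional null sets add up to a null
  set.\<close>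

lemma ess_support_vanish:
  assumes "ess_support S u \<subseteq> A"
  shows "AE z in lebesgue. z \<in> S - A \<longrightarrow> u z = 0"
proof -
  let ?F = "{U. open U \<and> (AE y in lebesgue. y \<in> U \<inter> S \<longrightarrow> u y = 0)}"
  obtain F' where F': "F' \<subseteq> ?F" "countable F'" "\<Union>F' = \<Union>?F"
    using Lindelof[of ?F] by blast
  have "AE y in lebesgue. \<forall>U\<in>F'. y \<in> U \<inter> S \<longrightarrow> u y = 0"
    using F'(1,2) by (subst AE_ball_countable) auto
  then show ?thesis
  proof eventually_elim
    case (elim z)
    show ?case
    proof
      assume z: "z \<in> S - A"
      then have "z \<in> \<Union>?F"
        using assms by (auto simp: ess_support_def)
      then obtain U where "U \<in> F'" "z \<in> U"
        using F'(3) by auto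
      then show "u z = 0"
        using elim z by auto
    qed
  qed
qed

text \<open>The support condition controls almost every time slice only; continuity in \<open>L\<^sup>2\<close>
  extends it to every slice, at the price of an enlargement by \<open>1\<close>.\<close>

lemma slice_vanishes_outside_cone:
  fixes u :: "real \<times> real \<Rightarrow> real"
  assumes cont: "C_L2 {0..<T} (\<lambda>t x. u (x, t))"
    and supp: "ess_support (UNIV \<times> {0..<T}) u \<subseteq> {(x, t). t \<in> {0..<T} \<and> \<bar>x\<bar> \<le> t + R}"
    and t: "t \<in> {0..<T}"
  shows "AE x in lebesgue. t + R + 1 < \<bar>x\<bar> \<longrightarrow> u (x, t) = 0"
proof -
  have good: "AE s in lebesgue. AE x in lebesgue. s \<in> {0..<T} \<and> s + R < \<bar>x\<bar> \<longrightarrow> u (x, s) = 0"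
  proof -
    have "AE z in lebesgue. snd z \<in> {0..<T} \<and> snd z + R < \<bar>fst z\<bar> \<longrightarrow> u z = 0"
      using ess_support_vanish[OF supp] by eventually_elim auto
    from AE_lebesgue_prod[OF this] show ?thesis by simp
  qed
  let ?A = "{x. t + R + 1 < \<bar>x\<bar>}"
  have L: "(\<lambda>x. u (x, s)) \<in> L2" if "s \<in> {0..<T}" for s
    using cont that by (auto simp: C_L2_def)
  have "?A = {..<- (t + R + 1)} \<union> {t + R + 1<..} \<or> ?A = UNIV"
    by (cases "t + R + 1 < 0") auto
  then have mA: "?A \<in> sets lebesgue"
    by (metis (no_types) borel_open lborelD open_Un open_UNIV open_greaterThan open_lessThan sets_completionI_sets sets_lborel)
  have int: "integrable lebesgue (\<lambda>x. indicator ?A x * (u (x, t))\<^sup>2)"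
    using integrable_mult_indicator[OF mA, of "\<lambda>x. (u (x, t))\<^sup>2"] L[OF t] by (simp add: L2_def)
  \<comment> \<open>The mass of u(t)^2 outside the enlarged cone. A nearby good slice u(s) vanishes
    there, so I is at most the squared L^2 distance of u(s) and u(t), which is small.\<close>
  define I where "I = (LINT x|lebesgue. indicator ?A x * (u (x, t))\<^sup>2)"
  have "I = 0"
  proof (rule ccontr)
    assume "I \<noteq> 0"
    moreover have "I \<ge> 0" by (simp add: I_def)
    ultimately have "0 < sqrt I" by simp
    moreover have "((\<lambda>s. L2_norm (\<lambda>x. u (x, s) - u (x, t))) \<longlongrightarrow> 0) (at t within {0..<T})"
      using cont t by (simp add: C_L2_def)
    ultimately have "\<forall>\<^sub>F s in at t within {0..<T}. L2_norm (\<lambda>x. u (x, s) - u (x, t)) < sqrt I"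
      by (rule order_tendstoD(2)[rotated])
    then obtain d where d: "d > 0" "\<And>s. s \<in> {0..<T} \<Longrightarrow> s \<noteq> t \<Longrightarrow> dist s t < d \<Longrightarrow>
        L2_norm (\<lambda>x. u (x, s) - u (x, t)) < sqrt I"
      unfolding eventually_at by blast
    \<comment> \<open>Keeps s within the continuity radius d, below T, and below t + 1, so that s +
      R < t + R + 1.\<close>
    define b where "b = min (t + d) (min (t + 1) T)"
    have "t < b" using d(1) t by (auto simp: b_def)
    then obtain s where s: "t < s" "s < b"
      "AE x in lebesgue. s \<in> {0..<T} \<and> s + R < \<bar>x\<bar> \<longrightarrow> u (x, s) = 0"
      using AE_lebesgue_imp_ex_greaterThanLessThan[OF good] by blast
    then have sT: "s \<in> {0..<T}" "s < t + 1" "dist s t < d"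
      using t by (auto simp: b_def dist_real_def)
    have "I \<le> (LINT x|lebesgue. (u (x, s) - u (x, t))\<^sup>2)"
      unfolding I_def
    proof (rule integral_mono_AE[OF int])
      show "integrable lebesgue (\<lambda>x. (u (x, s) - u (x, t))\<^sup>2)"
        using L2_diff[OF L[OF sT(1)] L[OF t]] by (simp add: L2_def)
      show "AE x in lebesgue. indicator ?A x * (u (x, t))\<^sup>2 \<le> (u (x, s) - u (x, t))\<^sup>2"
        using s(3) by eventually_elim (use sT in \<open>auto simp: indicator_def\<close>)
    qed
    also have "\<dots> = (L2_norm (\<lambda>x. u (x, s) - u (x, t)))\<^sup>2"
      by (simp add: L2_norm_def)
    also have "\<dots> < (sqrt I)\<^sup>2"
      using d(2)[OF sT(1) _ sT(3)] s(1) L2_norm_nonneg by (intro power_strict_mono) auto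
    also have "\<dots> = I" using \<open>I \<ge> 0\<close> by simp
    finally show False by simp
  qed
  then have "AE x in lebesgue. indicator ?A x * (u (x, t))\<^sup>2 = 0"
    using integral_nonneg_eq_0_iff_AE[OF int] by (auto simp: I_def)
  then show ?thesis
    by eventually_elim (auto simp: indicator_def split: if_splits)
qed

lemma locally_constant_DERIV_0:
  fixes f :: "real \<Rightarrow> real"
  assumes "open U" "x \<in> U" "\<And>y. y \<in> U \<Longrightarrow> f y = c" "(f has_real_derivative D) (at x)"
  shows "D = 0"
proof -
  have "((\<lambda>y. c) has_real_derivative D) (at x)"
    using has_field_derivative_transform_within_open[OF assms(4,1,2)] assms(3) by auto
  then show ?thesis
    using DERIV_unique[OF _ DERIV_const] by auto
qed

lemma smooth_alg_continuous: "smooth_alg f \<Longrightarrow> continuous_on S f"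
  using smooth_alg_smooth_on[of f S] C_k_on.simps(1) unfolding smooth_on_def by metis

lemma continuous_borel_measurable_lebesgue:
  fixes f :: "'a::euclidean_space \<Rightarrow> real"
  assumes "continuous_on UNIV f"
  shows "f \<in> borel_measurable lebesgue"
  using borel_measurable_continuous_onI[OF assms] by (simp add: measurable_completion)

lemma L2_of_bounded_support:
  assumes "smooth_alg \<psi>" "\<And>x. \<psi> x \<in> {0..1}" "\<And>x. x \<notin> {a..b} \<Longrightarrow> \<psi> x = 0"
  shows "\<psi> \<in> L2"
proof -
  have m: "\<psi> \<in> borel_measurable lebesgue"
    using assms(1) by (intro continuous_borel_measurable_lebesgue smooth_alg_continuous)
  have "integrable lebesgue (\<lambda>x. (\<psi> x)\<^sup>2)"
  proof (rule Bochner_Integration.integrable_bound[OF integrable_indicator_Icc[of a b]])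
    show "(\<lambda>x. (\<psi> x)\<^sup>2) \<in> borel_measurable lebesgue"
      using m by (rule borel_measurable_power)
    show "AE x in lebesgue. norm ((\<psi> x)\<^sup>2) \<le> norm (indicat_real {a..b} x)"
      using assms(2,3) by (intro AE_I2) (auto simp: indicator_def power_le_one)
  qed
  with m show ?thesis by (simp add: L2_def)
qed

section \<open>Averages of energy solutions\<close>

text \<open>As \<open>\<bar>u\<bar> powr p\<close> is only known to be integrable on compact subsets of \<open>\<real> \<times> (0, T)\<close>, the
  test function has to vanish near \<open>t = 0\<close>; the initial time is reached later by continuity
  of \<open>V\<close>.\<close>

lemma energy_solution_interior_inequality:
  fixes u :: "real \<times> real \<Rightarrow> real"
  assumes weak: "\<And>\<phi> t. \<phi> \<in> test_functions (UNIV \<times> {0..<T}) \<Longrightarrow> t \<in> {0..<T} \<Longrightarrow>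
           (LINT x|lebesgue. ut t x * \<phi> (x, t)) - (LINT x|lebesgue. ut 0 x * \<phi> (x, 0))
           + (LINT s:{0..t}|lebesgue. (LINT x|lebesgue.
                - ut s x * partial_t T \<phi> x s + ux s x * partial_x \<phi> x s))
           + (LINT s:{0..t}|lebesgue. (LINT x|lebesgue.
                \<mu> * ut s x / (1 + s) powr \<beta> * \<phi> (x, s)))
           = (LINT s:{0..t}|lebesgue. (LINT x|lebesgue. \<bar>u (x, s)\<bar> powr p * \<phi> (x, s)))"
    and H1: "C_H1_with {0..<T} (\<lambda>t x. u (x, t)) ux"
    and C1: "C1_L2_with {0..<T} (\<lambda>t x. u (x, t)) ut"
    and Lp: "Lp_loc p (UNIV \<times> {0<..<T}) u"
    and vanish: "\<And>t. t \<in> {0..<T} \<Longrightarrow> AE x in lebesgue. t + L < \<bar>x\<bar> \<longrightarrow> u (x, t) = 0"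
    and "L > 0" "p > 1"
    and \<psi>: "smooth_alg \<psi>" "\<And>x. \<psi> x \<in> {0..1}" "\<And>x. \<bar>x\<bar> \<le> M \<Longrightarrow> \<psi> x = 1"
      "\<And>x. M + 1 < \<bar>x\<bar> \<Longrightarrow> \<psi> x = 0"
    and M: "T + L \<le> M"
    and sr: "0 < s" "s < r" "r < T"
  defines "V \<equiv> \<lambda>t. LINT x|lebesgue. ut t x * \<psi> x"
    and "F \<equiv> \<lambda>t. LINT x|lebesgue. u (x, t) * \<psi> x"
  shows "integral {s..r} (\<lambda>t. (2 * (t + L)) powr (1 - p) * \<bar>F t\<bar> powr p)
    \<le> V r - V s + integral {s..r} (\<lambda>t. \<mu> / (1 + t) powr \<beta> * V t)"
proof -
  have \<psi>_L2: "\<psi> \<in> L2"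
    using \<psi> by (intro L2_of_bounded_support[of \<psi> "- (M + 1)" "M + 1"]) auto
  have L2: "(\<lambda>x. u (x, t)) \<in> L2" "ut t \<in> L2" "ux t \<in> L2"
    "has_weak_derivative (\<lambda>x. u (x, t)) (ux t)" if "t \<in> {0..<T}" for t
    using H1 C1 that by (auto simp: C_H1_with_def C1_L2_with_def C_L2_def)
  obtain \<psi>' where \<psi>': "smooth_alg \<psi>'" "\<And>x. (\<psi> has_real_derivative \<psi>' x) (at x)"
    using smooth_alg_has_real_derivative[OF \<psi>(1)] by blast
  obtain \<psi>'' where \<psi>'': "smooth_alg \<psi>''" "\<And>x. (\<psi>' has_real_derivative \<psi>'' x) (at x)"
    using smooth_alg_has_real_derivative[OF \<psi>'(1)] by blast
  have \<psi>'_in: "\<psi>' x = 0" if "\<bar>x\<bar> < M" for x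
    using that \<psi>(3) by (intro locally_constant_DERIV_0[OF _ _ _ \<psi>'(2), of "{-M<..<M}" x 1]) auto
  have \<psi>'_out: "\<psi>' x = 0" if "M + 1 < \<bar>x\<bar>" for x
    using that \<psi>(4) by (intro locally_constant_DERIV_0[OF _ _ _ \<psi>'(2), of "- {- (M + 1)..M + 1}" x 0]) auto
  have \<psi>''_in: "\<psi>'' x = 0" if "\<bar>x\<bar> < M" for x
    using that \<psi>'_in by (intro locally_constant_DERIV_0[OF _ _ _ \<psi>''(2), of "{-M<..<M}" x 0]) auto
  have \<psi>'_test: "\<psi>' \<in> test_functions UNIV"
    using \<psi>'_out by (intro test_functionsI[OF \<psi>'(1), of "{- (M + 1)..M + 1}"]) auto
  \<comment> \<open>The flux term vanishes: moving the weak derivative onto \<psi>' leaves u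
    \<psi>'', and \<psi>'' is zero for |x| < M, a region containing the part of the line where u(t)
    lives.\<close>
  have ux0: "(LINT x|lebesgue. ux t x * \<psi>' x) = 0" if t: "t \<in> {0..<T}" for t
  proof -
    have "deriv \<psi>' = \<psi>''"
      using \<psi>''(2) by (auto intro: DERIV_imp_deriv)
    then have "(LINT x|lebesgue. ux t x * \<psi>' x) = - (LINT x|lebesgue. u (x, t) * \<psi>'' x)"
      using L2(4)[OF t] \<psi>'_test unfolding has_weak_derivative_def by fastforce
    also have "(LINT x|lebesgue. u (x, t) * \<psi>'' x) = 0"
    proof (rule integral_eq_zero_AE)
      show "AE x in lebesgue. u (x, t) * \<psi>'' x = 0"
        using vanish[OF t]
      proof eventually_elim
        case (elim x)
        then show ?case
          using \<psi>''_in[of x] M t by (cases "t + L < \<bar>x\<bar>") auto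
      qed
    qed
    finally show ?thesis by simp
  qed
  \<comment> \<open>A third leaves room for two margins on each side of [s, r] inside (0, T): on the
    inner one \<eta> is still 1, across the outer one it falls to 0.\<close>
  define w where "w = min s (T - r) / 3"
  have w: "0 < w" "2 * w < s" "r + 2 * w < T"
    using sr by (auto simp: w_def min_def field_simps)
  obtain \<eta> where \<eta>: "smooth_alg \<eta>" "\<And>t. \<eta> t \<in> {0..1}" "\<And>t. t \<in> {s - w..r + w} \<Longrightarrow> \<eta> t = 1"
    "\<And>t. t \<notin> {s - w - w..r + w + w} \<Longrightarrow> \<eta> t = 0"
    using smooth_bump_exists[OF w(1)] by blast
  obtain \<eta>' where \<eta>': "smooth_alg \<eta>'" "\<And>t. (\<eta> has_real_derivative \<eta>' t) (at t)"
    using smooth_alg_has_real_derivative[OF \<eta>(1)] by blast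
  have \<eta>'_in: "\<eta>' t = 0" if "t \<in> {s..r}" for t
    using that \<eta>(3) w by (intro locally_constant_DERIV_0[OF _ _ _ \<eta>'(2), of "{s - w<..<r + w}" t 1]) auto
  define \<phi> where "\<phi> z = \<psi> (fst z) * \<eta> (snd z)" for z :: "real \<times> real"
  have \<phi>_smooth: "smooth_alg \<phi>"
    using smooth_alg.mult[OF smooth_alg_compose_affine[OF \<psi>(1) bounded_linear_fst, of 0]
        smooth_alg_compose_affine[OF \<eta>(1) bounded_linear_snd, of 0]]
    by (simp add: \<phi>_def[abs_def])
  define K where "K = {- (M + 1)..M + 1} \<times> {s - w - w..r + w + w}"
  have K: "compact K" "K \<subseteq> UNIV \<times> {0<..<T}"
    using w by (auto simp: K_def intro: compact_Times)
  have \<phi>_out: "\<phi> z = 0" if "z \<notin> K" for z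
    using that \<psi>(4)[of "fst z"] \<eta>(4)[of "snd z"] by (cases z) (auto simp: \<phi>_def K_def)
  have \<phi>_range: "\<phi> z \<in> {0..1}" for z
    using \<psi>(2) \<eta>(2) by (auto simp: \<phi>_def intro!: mult_le_one)
  have \<phi>_test: "\<phi> \<in> test_functions (UNIV \<times> {0..<T})"
    using K by (intro test_functionsI[OF \<phi>_smooth K(1) _ \<phi>_out]) auto
  have pt: "partial_t T \<phi> x t = \<psi> x * \<eta>' t" if t: "t \<in> {0..<T}" for x t
    unfolding partial_t_def
  proof (rule vector_derivative_within)
    have "(t + T) / 2 \<in> {0..<T}" "(t + T) / 2 \<noteq> t"
      using t by auto
    then have "\<nexists>a. {0..<T} = {a}"
      using t by (metis singletonD)
    then have "t islimpt {0..<T}"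
      using t by (intro connected_imp_perfect) auto
    then show "at t within {0..<T} \<noteq> bot"
      by (simp add: trivial_limit_within)
    have "((\<lambda>t. \<phi> (x, t)) has_real_derivative \<psi> x * \<eta>' t) (at t within {0..<T})"
      unfolding \<phi>_def using DERIV_subset[OF \<eta>'(2)] by (auto intro!: DERIV_cmult)
    then show "((\<lambda>t. \<phi> (x, t)) has_vector_derivative \<psi> x * \<eta>' t) (at t within {0..<T})"
      by (simp add: has_real_derivative_iff_has_vector_derivative)
  qed
  have px: "partial_x \<phi> x t = \<psi>' x * \<eta> t" for x t
    unfolding partial_x_def \<phi>_def by (intro DERIV_imp_deriv) (auto intro!: DERIV_cmult_right \<psi>'(2))
  define d where "d t = \<mu> / (1 + t) powr \<beta>" for t
  define H where "H t = (LINT x|lebesgue. \<bar>u (x, t)\<bar> powr p * \<psi> x)" for t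
  define A where "A t = - \<eta>' t * V t" for t
  define B where "B t = d t * \<eta> t * V t" for t
  define D where "D t = \<eta> t * H t" for t
  have \<psi>'_L2: "\<psi>' \<in> L2"
  proof -
    have c: "continuous_on UNIV \<psi>'" using \<psi>'(1) by (rule smooth_alg_continuous)
    have "integrable lebesgue (\<lambda>x. indicator {- (M + 1)..M + 1} x *\<^sub>R (\<psi>' x)\<^sup>2)"
      using absolutely_integrable_continuous_real[of "- (M + 1)" "M + 1" "\<lambda>x. (\<psi>' x)\<^sup>2"]
        continuous_on_subset[OF c subset_UNIV]
      by (auto simp: set_integrable_def intro!: continuous_intros)
    moreover have "(\<lambda>x. indicator {- (M + 1)..M + 1} x *\<^sub>R (\<psi>' x)\<^sup>2) = (\<lambda>x. (\<psi>' x)\<^sup>2)"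
    proof
      show "indicator {- (M + 1)..M + 1} x *\<^sub>R (\<psi>' x)\<^sup>2 = (\<psi>' x)\<^sup>2" for x
        using \<psi>'_out[of x] by (cases "M + 1 < \<bar>x\<bar>") (auto simp: indicator_def)
    qed
    ultimately show ?thesis
      using continuous_borel_measurable_lebesgue[OF c] by (simp add: L2_def)
  qed
  \<comment> \<open>For the product test function the weak formulation collapses to an identity
    between functions of time alone.\<close>
  have eq: "\<eta> \<tau> * V \<tau> - \<eta> 0 * V 0 + (LINT t:{0..\<tau>}|lebesgue. A t) + (LINT t:{0..\<tau>}|lebesgue. B t)
      = (LINT t:{0..\<tau>}|lebesgue. D t)" if \<tau>: "\<tau> \<in> {0..<T}" for \<tau>
  proof -
    have A: "(LINT x|lebesgue. - ut t x * partial_t T \<phi> x t + ux t x * partial_x \<phi> x t) = A t"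
      if "t \<in> {0..\<tau>}" for t
    proof -
      have t: "t \<in> {0..<T}" using that \<tau> by auto
      have "(LINT x|lebesgue. - ut t x * partial_t T \<phi> x t + ux t x * partial_x \<phi> x t)
          = (LINT x|lebesgue. - \<eta>' t * (ut t x * \<psi> x) + \<eta> t * (ux t x * \<psi>' x))"
        using pt[OF t] px by (intro Bochner_Integration.integral_cong) (auto simp: algebra_simps)
      also have "\<dots> = - \<eta>' t * V t + \<eta> t * (LINT x|lebesgue. ux t x * \<psi>' x)"
        unfolding V_def using L2[OF t] \<psi>_L2 \<psi>'_L2
        by (subst Bochner_Integration.integral_add) (auto intro!: integrable_mult_right L2_mult_integrable)
      finally show ?thesis using ux0[OF t] by (simp add: A_def)
    qed
    have B: "(LINT x|lebesgue. \<mu> * ut t x / (1 + t) powr \<beta> * \<phi> (x, t)) = B t" for t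
    proof -
      have "(LINT x|lebesgue. \<mu> * ut t x / (1 + t) powr \<beta> * \<phi> (x, t))
          = (LINT x|lebesgue. (d t * \<eta> t) * (ut t x * \<psi> x))"
        by (intro Bochner_Integration.integral_cong) (auto simp: d_def \<phi>_def)
      then show ?thesis by (simp add: B_def V_def)
    qed
    have D: "(LINT x|lebesgue. \<bar>u (x, t)\<bar> powr p * \<phi> (x, t)) = D t" for t
    proof -
      have "(LINT x|lebesgue. \<bar>u (x, t)\<bar> powr p * \<phi> (x, t))
          = (LINT x|lebesgue. \<eta> t * (\<bar>u (x, t)\<bar> powr p * \<psi> x))"
        by (intro Bochner_Integration.integral_cong) (auto simp: \<phi>_def)
      then show ?thesis by (simp add: D_def H_def)
    qed
    have V: "(LINT x|lebesgue. ut t x * \<phi> (x, t)) = \<eta> t * V t" for t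
    proof -
      have "(LINT x|lebesgue. ut t x * \<phi> (x, t)) = (LINT x|lebesgue. \<eta> t * (ut t x * \<psi> x))"
        by (intro Bochner_Integration.integral_cong) (auto simp: \<phi>_def)
      then show ?thesis by (simp add: V_def)
    qed
    have "(LINT t:{0..\<tau>}|lebesgue. (LINT x|lebesgue. - ut t x * partial_t T \<phi> x t + ux t x * partial_x \<phi> x t))
        = (LINT t:{0..\<tau>}|lebesgue. A t)"
      using A by (intro set_lebesgue_integral_cong) auto
    then show ?thesis
      using weak[OF \<phi>_test \<tau>] by (simp only: B D V)
  qed
  have cV: "continuous_on {0..<T} V"
    unfolding V_def using C1 \<psi>_L2 by (intro C_L2_pairing_continuous) (auto simp: C1_L2_with_def)
  have sub: "{0..r} \<subseteq> {0..<T}" using sr by auto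
  have cd: "continuous_on {0..r} d"
    unfolding d_def by (intro continuous_intros) auto
  have cA: "continuous_on {0..r} A" and cB: "continuous_on {0..r} B"
    unfolding A_def B_def
    by (intro continuous_intros cd continuous_on_subset[OF cV sub] smooth_alg_continuous \<eta> \<eta>')+
  \<comment> \<open>\<phi> lives on the compact set K inside the open strip, where local
    integrability of |u|^p is available.\<close>
  have G: "integrable lebesgue (\<lambda>z. \<bar>u z\<bar> powr p * \<phi> z)"
  proof -
    have i: "integrable lebesgue (\<lambda>z. indicator K z *\<^sub>R \<bar>u z\<bar> powr p)"
      using Lp K by (auto simp: Lp_loc_def set_integrable_def)
    have "integrable lebesgue (\<lambda>z. (indicator K z *\<^sub>R \<bar>u z\<bar> powr p) * \<phi> z)"
    proof (rule Bochner_Integration.integrable_bound[OF i])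
      show "(\<lambda>z. (indicator K z *\<^sub>R \<bar>u z\<bar> powr p) * \<phi> z) \<in> borel_measurable lebesgue"
        by (intro borel_measurable_times borel_measurable_integrable[OF i]
            continuous_borel_measurable_lebesgue smooth_alg_continuous \<phi>_smooth)
      show "AE z in lebesgue. norm ((indicator K z *\<^sub>R \<bar>u z\<bar> powr p) * \<phi> z) \<le> norm (indicator K z *\<^sub>R \<bar>u z\<bar> powr p)"
        using \<phi>_range by (intro AE_I2) (auto simp: abs_mult indicator_def intro!: mult_left_le)
    qed
    moreover have "(\<lambda>z. (indicator K z *\<^sub>R \<bar>u z\<bar> powr p) * \<phi> z) = (\<lambda>z. \<bar>u z\<bar> powr p * \<phi> z)"
      using \<phi>_out by (intro ext) (auto simp: indicator_def)
    ultimately show ?thesis by simp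
  qed
  have D_eq: "(LINT x|lebesgue. \<bar>u (x, t)\<bar> powr p * \<phi> (x, t)) = D t" for t
    by (simp add: D_def H_def \<phi>_def mult.assoc[symmetric])
  have D_int: "integrable lebesgue D"
    using integrable_lebesgue_prod_slice(2)[OF G] by (simp add: D_eq)
  have iA: "set_integrable lebesgue {0..r} A" and iB: "set_integrable lebesgue {0..r} B"
    using cA cB by (simp_all add: absolutely_integrable_continuous_real)
  have iD: "set_integrable lebesgue {0..r} D"
    unfolding set_integrable_def by (rule integrable_mult_indicator[OF _ D_int]) simp
  have split: "(LINT t:{0..r}|lebesgue. f t) - (LINT t:{0..s}|lebesgue. f t) = integral {s..r} f"
    if "set_integrable lebesgue {0..r} f" for f :: "real \<Rightarrow> real"
  proof -
    have "set_integrable lebesgue {0..s} f"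
      using sr by (intro set_integrable_subset[OF that]) auto
    then show ?thesis
      using that sr Henstock_Kurzweil_Integration.integral_combine[of 0 s r f]
      by (simp add: set_lebesgue_integral_eq_integral)
  qed
  \<comment> \<open>The identity at r minus the identity at s removes the term at time 0 and all of
    [0, s], where \<eta> is not constant.\<close>
  have "V r - V s + integral {s..r} A + integral {s..r} B = integral {s..r} D"
    using eq[of r] eq[of s] split[OF iA] split[OF iB] split[OF iD] \<eta>(3)[of r] \<eta>(3)[of s] w sr by simp
  moreover have "integral {s..r} A = integral {s..r} (\<lambda>t. 0)"
    using \<eta>'_in by (intro Henstock_Kurzweil_Integration.integral_cong) (simp add: A_def)
  moreover have "integral {s..r} B = integral {s..r} (\<lambda>t. d t * V t)"
    using \<eta>(3) w by (intro Henstock_Kurzweil_Integration.integral_cong) (simp add: B_def)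
  moreover have "integral {s..r} (\<lambda>t. (2 * (t + L)) powr (1 - p) * \<bar>F t\<bar> powr p) \<le> integral {s..r} D"
  proof -
    let ?k = "\<lambda>t. (2 * (t + L)) powr (1 - p) * \<bar>F t\<bar> powr p"
    have "continuous_on {0..<T} F"
      unfolding F_def using C1_L2_pairing_has_derivative[OF C1 \<psi>_L2] by (rule DERIV_continuous_on)
    then have "continuous_on {s..r} F"
      by (rule continuous_on_subset) (use sr in auto)
    then have "continuous_on {s..r} ?k"
      using \<open>p > 1\<close> \<open>L > 0\<close> sr by (intro continuous_intros continuous_on_powr') auto
    then have ik: "set_integrable lebesgue {s..r} ?k"
      by (rule absolutely_integrable_continuous_real)
    have iD': "set_integrable lebesgue {s..r} D"
      using sr by (intro set_integrable_subset[OF iD]) auto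
    have "(LINT t:{s..r}|lebesgue. ?k t) \<le> (LINT t:{s..r}|lebesgue. D t)"
      unfolding set_lebesgue_integral_def
    proof (rule integral_mono_AE)
      \<comment> \<open>Jensen needs |u|^p \<psi> integrable on the slice, which Fubini gives for
        almost every t; there \<eta> = 1 on [s, r].\<close>
      show "AE t in lebesgue. indicator {s..r} t *\<^sub>R ?k t \<le> indicator {s..r} t *\<^sub>R D t"
        using integrable_lebesgue_prod_slice(1)[OF G]
      proof eventually_elim
        case (elim t)
        show ?case
        proof (cases "t \<in> {s..r}")
          case True
          then have t: "t \<in> {0..<T}" and "0 < t + L" and \<eta>1: "\<eta> t = 1"
            using sr \<open>L > 0\<close> w \<eta>(3) by auto
          have "?k t \<le> H t"
            unfolding F_def H_def
          proof (rule Jensen_powr_interval[OF L2(1)[OF t] \<open>0 < t + L\<close> \<open>p > 1\<close> vanish[OF t]])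
            show "0 \<le> \<psi> x" for x using \<psi>(2)[of x] by simp
            show "\<psi> x = 1" if "\<bar>x\<bar> \<le> t + L" for x
              using that t M by (intro \<psi>(3)) auto
            show "integrable lebesgue (\<lambda>x. \<bar>u (x, t)\<bar> powr p * \<psi> x)"
              using elim \<eta>1 by (simp add: \<phi>_def)
          qed
          then show ?thesis using \<eta>1 by (simp add: D_def mult_left_mono)
        qed simp
      qed
    qed (use ik iD' in \<open>auto simp: set_integrable_def\<close>)
    then show ?thesis
      using ik iD' by (simp add: set_lebesgue_integral_eq_integral)
  qed
  ultimately show ?thesis by (simp add: d_def)
qed

text \<open>A function in L^2 may have infinite integral over the line, so its mass is detected on a
  bounded interval: if every truncated integral vanished, g would be 0 almost everywhere.\<close>

lemma exists_interval_integral_pos: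
  assumes g: "g \<in> L2" and nonneg: "AE x in lebesgue. 0 \<le> g x"
    and nz: "(\<integral>\<^sup>+ x. ennreal (g x) \<partial>lebesgue) \<noteq> 0"
  obtains N :: nat where "0 < (LINT x|lebesgue. indicator {-real N..real N} x * g x)"
proof -
  let ?I = "\<lambda>N x. indicat_real {-real N..real N} x * g x"
  have nonneg': "AE x in lebesgue. 0 \<le> ?I N x" for N
    using nonneg by eventually_elim simp
  have "\<exists>N. (LINT x|lebesgue. ?I N x) \<noteq> 0"
  proof (rule ccontr)
    assume none: "\<not> (\<exists>N. (LINT x|lebesgue. ?I N x) \<noteq> 0)"
    have "AE x in lebesgue. ?I N x = 0" for N
      using integral_nonneg_eq_0_iff_AE[OF L2_integrable_on_interval[OF g] nonneg'] none by simp
    then have "AE x in lebesgue. \<forall>N. ?I N x = 0"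
      unfolding AE_all_countable by blast
    then have ae: "AE x in lebesgue. ennreal (g x) = 0"
    proof eventually_elim
      case (elim x)
      obtain N where "\<bar>x\<bar> \<le> real N" using real_arch_simple by blast
      then show ?case using elim[rule_format, of N] by (simp add: indicator_def abs_le_iff minus_le_iff)
    qed
    show False
      using nn_integral_cong_AE[of "\<lambda>x. ennreal (g x)" "\<lambda>_. 0" lebesgue] ae nz by simp
  qed
  then obtain N where "(LINT x|lebesgue. ?I N x) \<noteq> 0" by blast
  moreover have "0 \<le> (LINT x|lebesgue. ?I N x)"
    using nonneg' by (rule integral_nonneg_AE)
  ultimately show ?thesis using that[of N] by linarith
qed

text \<open>Supplies the hypotheses of \<open>lifespan_of_integral_inequality\<close> with
  coefficient m0, growth rate m0 c \<epsilon> and L = R + 1, the extra 1 coming from the enlarged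
  cone. None of these constants depends on T or u.\<close>

lemma energy_solution_average_inequalities:
  assumes pos: "\<mu> > 0" "\<beta> > 1" "R \<ge> 1" "p > 1" "\<epsilon> > 0"
    and g: "g \<in> L2" and f_nonneg: "AE x in lebesgue. 0 \<le> f x" and g_nonneg: "AE x in lebesgue. 0 \<le> g x"
    and c: "c = (LINT x|lebesgue. indicator {-N..N} x * g x)" "c > 0"
    and sol: "energy_solution p \<mu> \<beta> T (\<lambda>x. \<epsilon> * f x) (\<lambda>x. \<epsilon> * g x) u"
    and supp: "ess_support (UNIV \<times> {0..<T}) u \<subseteq> {(x, t). t \<in> {0..<T} \<and> \<bar>x\<bar> \<le> t + R}"
  defines "m0 \<equiv> exp (- (\<mu> / (\<beta> - 1)))"
  obtains F where "\<And>t. 0 \<le> t \<Longrightarrow> t < T \<Longrightarrow> m0 * (c * \<epsilon>) * t \<le> F t"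
    "\<And>s r. 0 \<le> s \<Longrightarrow> s \<le> r \<Longrightarrow> r < T \<Longrightarrow>
       F s + m0 * (2 * (r + (R + 1))) powr (1 - p) * F s powr p * (r - s)\<^sup>2 / 2 \<le> F r"
proof -
  obtain ut ux where
    Lp: "Lp_loc p (UNIV \<times> {0<..<T}) u"
    and H1: "C_H1_with {0..<T} (\<lambda>t x. u (x, t)) ux"
    and C1: "C1_L2_with {0..<T} (\<lambda>t x. u (x, t)) ut"
    and u0: "AE x in lebesgue. u (x, 0) = \<epsilon> * f x"
    and u1: "AE x in lebesgue. ut 0 x = \<epsilon> * g x"
    and weak: "\<And>\<phi> t. \<phi> \<in> test_functions (UNIV \<times> {0..<T}) \<Longrightarrow> t \<in> {0..<T} \<Longrightarrow>
           (LINT x|lebesgue. ut t x * \<phi> (x, t)) - (LINT x|lebesgue. ut 0 x * \<phi> (x, 0))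
           + (LINT s:{0..t}|lebesgue. (LINT x|lebesgue.
                - ut s x * partial_t T \<phi> x s + ux s x * partial_x \<phi> x s))
           + (LINT s:{0..t}|lebesgue. (LINT x|lebesgue.
                \<mu> * ut s x / (1 + s) powr \<beta> * \<phi> (x, s)))
           = (LINT s:{0..t}|lebesgue. (LINT x|lebesgue. \<bar>u (x, s)\<bar> powr p * \<phi> (x, s)))"
    using sol unfolding energy_solution_def by blast
  \<comment> \<open>The cutoff must be 1 on the enlarged cone up to time T and also on [-N, N],
    where the mass c of g is measured.\<close>
  define M where "M = max (T + (R + 1)) N"
  have M_ge: "T + (R + 1) \<le> M" "N \<le> M"
    unfolding M_def by (rule max.cobounded1, rule max.cobounded2)
  obtain \<psi> where \<psi>: "smooth_alg \<psi>" "\<And>x. \<psi> x \<in> {0..1}" "\<And>x. x \<in> {-M..M} \<Longrightarrow> \<psi> x = 1"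
    "\<And>x. x \<notin> {-M - 1..M + 1} \<Longrightarrow> \<psi> x = 0"
    using smooth_bump_exists[of 1 "-M" M] by auto
  have \<psi>_abs: "\<bar>x\<bar> \<le> M \<Longrightarrow> \<psi> x = 1" "M + 1 < \<bar>x\<bar> \<Longrightarrow> \<psi> x = 0" for x
    using \<psi>(3,4)[of x] by (cases "0 \<le> x"; simp)+
  have \<psi>_L2: "\<psi> \<in> L2"
    by (rule L2_of_bounded_support[OF \<psi>(1,2,4)])
  have uL2: "C_L2 {0..<T} (\<lambda>t x. u (x, t))"
    unfolding C_L2_def
  proof (intro conjI ballI)
    fix t assume t: "t \<in> {0..<T}"
    then show "(\<lambda>x. u (x, t)) \<in> L2" using C1 by (auto simp: C1_L2_with_def)
    let ?a = "\<lambda>s. L2_norm (\<lambda>x. u (x, s) - u (x, t))" and ?b = "\<lambda>s. L2_norm (\<lambda>x. ux s x - ux t x)"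
    have "((\<lambda>s. sqrt ((?a s)\<^sup>2 + (?b s)\<^sup>2)) \<longlongrightarrow> 0) (at t within {0..<T})"
      using H1 t by (auto simp: C_H1_with_def)
    then show "(?a \<longlongrightarrow> 0) (at t within {0..<T})"
      by (rule Lim_null_comparison[rotated])
        (auto intro!: always_eventually real_le_rsqrt simp: L2_norm_nonneg)
  qed
  have vanish: "AE x in lebesgue. t + (R + 1) < \<bar>x\<bar> \<longrightarrow> u (x, t) = 0" if "t \<in> {0..<T}" for t
    using slice_vanishes_outside_cone[OF uL2 supp that] by (simp add: add.assoc)
  define V where "V t = (LINT x|lebesgue. ut t x * \<psi> x)" for t
  define F where "F t = (LINT x|lebesgue. u (x, t) * \<psi> x)" for t
  have cV: "continuous_on {0..<T} V"
    unfolding V_def using C1 \<psi>_L2 by (intro C_L2_pairing_continuous) (auto simp: C1_L2_with_def)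
  have dF: "(F has_real_derivative V t) (at t within {0..<T})" if "t \<in> {0..<T}" for t
    unfolding F_def V_def using C1_L2_pairing_has_derivative[OF C1 \<psi>_L2 that] .
  have ineq: "integral {s..r} (\<lambda>t. (2 * (t + (R + 1))) powr (1 - p) * \<bar>F t\<bar> powr p)
      \<le> V r - V s + integral {s..r} (\<lambda>t. \<mu> / (1 + t) powr \<beta> * V t)"
    if "0 < s" "s < r" "r < T" for s r
    unfolding F_def V_def
    by (rule energy_solution_interior_inequality[OF weak H1 C1 Lp vanish _ pos(4) \<psi>(1,2) \<psi>_abs _ that])
      (use pos M_ge in auto)
  have F0: "0 \<le> F 0"
    unfolding F_def
  proof (rule integral_nonneg_AE)
    show "AE x in lebesgue. 0 \<le> u (x, 0) * \<psi> x"
      using u0 f_nonneg by eventually_elim (use \<psi>(2) pos in auto)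
  qed
  \<comment> \<open>Counting only the mass on [-N, N] makes the bound independent of \<psi>, hence
    of T.\<close>
  have V0: "c * \<epsilon> \<le> V 0" if "T > 0"
  proof -
    have "c * \<epsilon> = (LINT x|lebesgue. \<epsilon> * (indicator {-N..N} x * g x))"
      by (simp add: c(1))
    also have "\<dots> \<le> V 0"
      unfolding V_def
    proof (rule integral_mono_AE)
      show "integrable lebesgue (\<lambda>x. \<epsilon> * (indicator {-N..N} x * g x))"
        using L2_integrable_on_interval[OF g] by (rule integrable_mult_right)
      show "integrable lebesgue (\<lambda>x. ut 0 x * \<psi> x)"
        using C1 that \<psi>_L2 by (intro L2_mult_integrable) (auto simp: C1_L2_with_def C_L2_def)
      show "AE x in lebesgue. \<epsilon> * (indicator {-N..N} x * g x) \<le> ut 0 x * \<psi> x"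
        using u1 g_nonneg
      proof eventually_elim
        case (elim x)
        have "indicator {-N..N} x \<le> \<psi> x"
          using \<psi>(2)[of x] \<psi>(3)[of x] M_ge(2) by (auto simp: indicator_def)
        then have "indicator {-N..N} x * (\<epsilon> * g x) \<le> \<psi> x * (\<epsilon> * g x)"
          using elim pos by (intro mult_right_mono) auto
        then show ?case using elim by (simp add: mult_ac)
      qed
    qed
    finally show ?thesis .
  qed
  \<comment> \<open>The exponent is minus the integral of \<mu> (1 + s)^(-\<beta>) over [t,
    \<infinity>), finite because \<beta> > 1; so m \<le> 1, and its smallest value, at t = 0, is
    m0.\<close>
  define m where "m t = exp (- (\<mu> / (\<beta> - 1)) * (1 + t) powr (1 - \<beta>))" for t
  have dm: "(m has_real_derivative \<mu> / (1 + t) powr \<beta> * m t) (at t within A)" if "0 \<le> t" for t A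
  proof -
    have d: "((\<lambda>t. - (\<mu> / (\<beta> - 1)) * (1 + t) powr (1 - \<beta>)) has_real_derivative
        - (\<mu> / (\<beta> - 1)) * ((1 - \<beta>) * (1 + t) powr (- \<beta>))) (at t within A)"
      using that pos by (auto intro!: derivative_eq_intros)
    have "- (\<mu> / (\<beta> - 1)) * ((1 - \<beta>) * (1 + t) powr (- \<beta>))
        = \<mu> / (\<beta> - 1) * (\<beta> - 1) * (1 + t) powr (- \<beta>)"
      by (simp only: algebra_simps)
    also have "\<dots> = \<mu> / (1 + t) powr \<beta>"
      using pos by (simp add: powr_minus divide_inverse)
    finally show ?thesis
      using DERIV_chain'[OF d DERIV_exp] by (simp add: m_def[abs_def] mult.commute)
  qed
  have m_bounds: "m0 \<le> m t \<and> m t \<le> 1" if "0 \<le> t" for t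
  proof -
    have "(1 + t) powr (1 - \<beta>) \<le> 1 powr (1 - \<beta>)"
      using that pos by (intro powr_mono2') auto
    then have "\<mu> / (\<beta> - 1) * (1 + t) powr (1 - \<beta>) \<le> \<mu> / (\<beta> - 1) * 1"
      using pos by (intro mult_left_mono) auto
    then show ?thesis using pos by (auto simp: m_def m0_def)
  qed
  have "m0 > 0" by (simp add: m0_def)
  \<comment> \<open>The second-order inequality lives on compact intervals, so it is applied on
    [0, r] for each r < T, with constants that do not depend on r.\<close>
  have main: "m0 * V 0 * r \<le> F r"
      "0 \<le> s \<Longrightarrow> s \<le> r \<Longrightarrow> F s + m0 * (2 * (r + (R + 1))) powr (1 - p) * F s powr p * (r - s)\<^sup>2 / 2 \<le> F r"
    if r: "0 < r" "r < T" for s r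
  proof -
    have sub: "{0..r} \<subseteq> {0..<T}" using r by auto
    have dF': "(F has_real_derivative V t) (at t within {0..r})" if "t \<in> {0..r}" for t
      by (rule DERIV_subset[OF dF sub]) (use that sub in blast)
    have cd: "continuous_on {0..r} (\<lambda>t. \<mu> / (1 + t) powr \<beta>)"
      by (intro continuous_intros) auto
    have ck: "continuous_on {0..r} (\<lambda>t. (2 * (t + (R + 1))) powr (1 - p))"
      using pos by (intro continuous_intros) auto
    have V0': "0 < V 0"
    proof -
      have "0 < c * \<epsilon>" using c pos by simp
      then show ?thesis using V0 r by linarith
    qed
    note * = damped_second_order_inequality[OF r(1) pos(4) continuous_on_subset[OF cV sub] cd ck dF' ineq dm
        _ _ _ m_bounds \<open>m0 > 0\<close> F0 V0']
    show "m0 * V 0 * r \<le> F r"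
      by (rule *(1)) (use pos r in \<open>auto intro!: powr_mono2'\<close>)
    show "F s + m0 * (2 * (r + (R + 1))) powr (1 - p) * F s powr p * (r - s)\<^sup>2 / 2 \<le> F r" if "0 \<le> s" "s \<le> r"
      by (rule *(2)) (use pos r that in \<open>auto intro!: powr_mono2'\<close>)
  qed
  show ?thesis
  proof (rule that[of F])
    fix t :: real assume t: "0 \<le> t" "t < T"
    have "m0 * (c * \<epsilon>) * t \<le> m0 * V 0 * t"
      using V0 t \<open>m0 > 0\<close> by (intro mult_right_mono mult_left_mono) auto
    also have "\<dots> \<le> F t"
      using main(1)[of t] t F0 by (cases "t = 0") auto
    finally show "m0 * (c * \<epsilon>) * t \<le> F t" .
  next
    fix s r :: real assume "0 \<le> s" "s \<le> r" "r < T"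
    then show "F s + m0 * (2 * (r + (R + 1))) powr (1 - p) * F s powr p * (r - s)\<^sup>2 / 2 \<le> F r"
      using main(2)[of r s] by (cases "r = 0") auto
  qed
qed

section \<open>Choice of constants and conclusion\<close>

theorem theorem2p3:
  fixes \<mu> \<beta> R p :: real and f g :: "real \<Rightarrow> real"
  assumes "\<mu> > 0" and "\<beta> > 1" and "R \<ge> 1" and "p > 1"
    and "f \<in> H1" and "g \<in> L2"
    and "AE x in lebesgue. 0 \<le> f x" and "AE x in lebesgue. 0 \<le> g x"
    and "\<not> (AE x in lebesgue. f x = 0)"
    and "(\<integral>\<^sup>+ x. ennreal (g x) \<partial>lebesgue) \<noteq> 0"
  shows "\<exists>\<epsilon>\<^sub>0>0. \<exists>C>0. \<forall>\<epsilon>. 0 < \<epsilon> \<and> \<epsilon> \<le> \<epsilon>\<^sub>0 \<longrightarrow>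
           (\<forall>T>0. \<forall>u.
              energy_solution p \<mu> \<beta> T (\<lambda>x. \<epsilon> * f x) (\<lambda>x. \<epsilon> * g x) u \<and>
              ess_support (UNIV \<times> {0..<T}) u \<subseteq> {(x, t). t \<in> {0..<T} \<and> \<bar>x\<bar> \<le> t + R} \<longrightarrow>
              T \<le> C * \<epsilon> powr (- (p - 1) / 2))"
proof -
  define m0 where "m0 = exp (- (\<mu> / (\<beta> - 1)))"
  have "m0 > 0" by (simp add: m0_def)
  obtain N :: nat where N: "0 < (LINT x|lebesgue. indicator {-real N..real N} x * g x)"
    using exists_interval_integral_pos[OF assms(6,8,10)] by blast
  define c where "c = (LINT x|lebesgue. indicator {-real N..real N} x * g x)"
  have "c > 0" using N by (simp add: c_def)
  have R_pos: "0 < R + 1" using \<open>R \<ge> 1\<close> by simp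
  obtain C where "C > 0" and C: "\<forall>a T F. 0 < a \<and> a \<le> 1 \<and> (\<forall>s. 0 \<le> s \<and> s < T \<longrightarrow> a * s \<le> F s) \<and>
      (\<forall>s r. 0 \<le> s \<and> s \<le> r \<and> r < T \<longrightarrow>
         F s + m0 * (2 * (r + (R + 1))) powr (1 - p) * F s powr p * (r - s)\<^sup>2 / 2 \<le> F r) \<longrightarrow>
      T \<le> C * a powr (- (p - 1) / 2)"
    using lifespan_of_integral_inequality[OF \<open>p > 1\<close> \<open>m0 > 0\<close> R_pos] by blast
  \<comment> \<open>The threshold 1 / (m0 c) makes the growth rate a = m0 c \<epsilon> at most 1.
    Both C and c are fixed before \<epsilon>, T and u.\<close>
  have bound: "T \<le> C * (m0 * c) powr (- (p - 1) / 2) * \<epsilon> powr (- (p - 1) / 2)"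
    if \<epsilon>: "0 < \<epsilon>" "\<epsilon> \<le> 1 / (m0 * c)"
      and sol: "energy_solution p \<mu> \<beta> T (\<lambda>x. \<epsilon> * f x) (\<lambda>x. \<epsilon> * g x) u"
        "ess_support (UNIV \<times> {0..<T}) u \<subseteq> {(x, t). t \<in> {0..<T} \<and> \<bar>x\<bar> \<le> t + R}"
    for \<epsilon> T u
  proof -
    obtain F where F: "\<And>t. 0 \<le> t \<Longrightarrow> t < T \<Longrightarrow> m0 * (c * \<epsilon>) * t \<le> F t"
      "\<And>s r. 0 \<le> s \<Longrightarrow> s \<le> r \<Longrightarrow> r < T \<Longrightarrow>
         F s + m0 * (2 * (r + (R + 1))) powr (1 - p) * F s powr p * (r - s)\<^sup>2 / 2 \<le> F r"
      using energy_solution_average_inequalities[OF assms(1-4) \<epsilon>(1) assms(6-8) c_def \<open>c > 0\<close> sol]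
      unfolding m0_def by blast
    have "0 < m0 * (c * \<epsilon>)" "m0 * (c * \<epsilon>) \<le> 1"
      using \<epsilon> \<open>m0 > 0\<close> \<open>c > 0\<close> by (simp_all add: field_simps)
    then have "T \<le> C * (m0 * (c * \<epsilon>)) powr (- (p - 1) / 2)"
      using F C by blast
    also have "(m0 * (c * \<epsilon>)) powr (- (p - 1) / 2) = (m0 * c) powr (- (p - 1) / 2) * \<epsilon> powr (- (p - 1) / 2)"
      using \<epsilon> \<open>m0 > 0\<close> \<open>c > 0\<close> by (simp add: powr_mult mult.assoc)
    finally show ?thesis by (simp add: mult.assoc)
  qed
  show ?thesis
  proof (intro exI conjI allI impI)
    show "1 / (m0 * c) > 0" "C * (m0 * c) powr (- (p - 1) / 2) > 0"
      using \<open>m0 > 0\<close> \<open>c > 0\<close> \<open>C > 0\<close> by simp_all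
  qed (use bound in blast)
qed

end
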